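(* Let $\mathfrak{A}$ be a unital C*-algebra, $\mathfrak{H}$ a Hilbert $\mathfrak{A}$-module and $\mathcal{G}:=((\mathfrak{H}_n,\omega_n))_{n\in\mathbb{N}^*}$ a *-fusion frame of $\mathfrak{H}$. Then the mapping $$\mathcal{S}_{\mathcal{G}}:\mathfrak{H}\to\mathfrak{H},\qquad x\mapsto\sum_{n=1}^{+\infty}\omega_n^2P_{\mathfrak{H}_n}(x)$$ is a well-defined (i.e. the series converges in $\mathfrak{H}$ for every $x\in\mathfrak{H}$) bounded linear, positive, self-adjoint and invertible operator. Furthermore the following reconstruction formula holds: $$x=\sum_{n=1}^{+\infty}\omega_n^2P_{\mathfrak{H}_n}\left(\mathcal{S}_{\mathcal{G}}^{-1}(x)\right),\qquad x\in\mathfrak{H}.$$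
   Context: $\mathbb{N}^*=\{1,2,3,\dots\}$. Hilbert $\mathfrak{A}$-modules are left modules with $\mathfrak{A}$-valued inner product $\langle\cdot,\cdot\rangle$ that is $\mathfrak{A}$-linear in the first variable; $|x|:=\langle x,x\rangle^{1/2}\in\mathfrak{A}$ and $\|x\|_{\mathfrak{H}}:=\||x|\|_{\mathfrak{A}}$. For $a,b\in\mathfrak{A}$, $a\preccurlyeq b$ means that $b-a$ is positive. An element of $\mathfrak{A}$ is strictly positive if every nonzero positive linear form takes a value $>0$ on it; since $\mathfrak{A}$ is unital this is equivalent to being positive and invertible. A closed submodule $\mathfrak{K}$ of $\mathfrak{H}$ is orthogonally complemented if $\mathfrak{H}=\mathfrak{K}\oplus\mathfrak{K}^\perp$, where $\mathfrak{K}^\perp=\{u\in\mathfrak{H}:\langle u,x\rangle=0\ \forall x\in\mathfrak{K}\}$; $P_{\mathfrak{K}}$ denotes the corresponding orthogonal projection of $\mathfrak{H}$ onto $\mathfrak{K}$. A weight of $\mathfrak{A}$ is a sequence $(\omega_n)_{n\in\mathbb{N}^*}$ of central and strictly positive elements of $\mathfrak{A}$. Given a sequence $(\mathfrak{H}_n)_{n\in\mathbb{N}^*}$ of orthogonally complemented submodules of $\mathfrak{H}$ and a weight $(\omega_n)_{n\in\mathbb{N}^*}$ of $\mathfrak{A}$, the sequence $((\mathfrak{H}_n,\omega_n))_{n\in\mathbb{N}^*}$ is a *-fusion frame of $\mathfrak{H}$ if for each $x\in\mathfrak{H}$ the series $\sum\omega_n^2|P_{\mathfrak{H}_n}(x)|^2$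 converges in the norm of $\mathfrak{A}$ and there exist two strictly positive elements $A,B$ of $\mathfrak{A}$ such that $|Ax|^2\preccurlyeq\sum_{n=1}^{+\infty}\omega_n^2|P_{\mathfrak{H}_n}(x)|^2\preccurlyeq|Bx|^2$ for all $x\in\mathfrak{H}$. Positivity and self-adjointness of an operator on $\mathfrak{H}$ are understood in the C*-algebra of adjointable operators from $\mathfrak{H}$ to itself. *)

theory Defs
  imports "HOL-Analysis.Analysis"
begin

section \<open>Unital C*-algebras\<close>

class scaleC =
  fixes scaleC :: "complex \<Rightarrow> 'a \<Rightarrow> 'a"  (infixr \<open>*\<^sub>C\<close> 75)

class complex_normed_vector = scaleC + real_normed_vector +
  assumes scaleC_add_right: "c *\<^sub>C (x + y) = c *\<^sub>C x + c *\<^sub>C y"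
    and scaleC_add_left: "(c + d) *\<^sub>C x = c *\<^sub>C x + d *\<^sub>C x"
    and scaleC_scaleC: "c *\<^sub>C d *\<^sub>C x = (c * d) *\<^sub>C x"
    and scaleC_of_real: "complex_of_real r *\<^sub>C x = r *\<^sub>R x"
    and norm_scaleC: "norm (c *\<^sub>C x) = cmod c * norm x"

text \<open>
  The class \<^class>\<open>monoid_mult\<close> provides the unit without imposing \<open>1 \<noteq> 0\<close>, so the zero
  algebra is included; otherwise \<open>norm 1 = 1\<close> follows from the C*-identity.
\<close>

class unital_cstar_algebra =
  complex_normed_vector + banach + real_normed_algebra + monoid_mult +
  fixes star :: "'a \<Rightarrow> 'a"
  assumes scaleC_mult_left: "(c *\<^sub>C a) * b = c *\<^sub>C (a * b)"
    and scaleC_mult_right: "a * (c *\<^sub>C b) = c *\<^sub>C (a * b)"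
    and star_add: "star (a + b) = star a + star b"
    and star_scaleC: "star (c *\<^sub>C a) = cnj c *\<^sub>C star a"
    and star_mult: "star (a * b) = star b * star a"
    and star_star: "star (star a) = a"
    and cstar_identity: "norm (star a * a) = (norm a)\<^sup>2"

definition alg_invertible :: "'a::unital_cstar_algebra \<Rightarrow> bool" where
  "alg_invertible a \<longleftrightarrow> (\<exists>b. a * b = 1 \<and> b * a = 1)"

definition alg_spectrum :: "'a::unital_cstar_algebra \<Rightarrow> complex set" where
  "alg_spectrum a = {c. \<not> alg_invertible (a - c *\<^sub>C 1)}"

definition positive :: "'a::unital_cstar_algebra \<Rightarrow> bool" where
  "positive a \<longleftrightarrow> star a = a \<and> alg_spectrum a \<subseteq> \<real>\<^sub>\<ge>\<^sub>0"

definition cstar_le :: "'a::unital_cstar_algebra \<Rightarrow> 'a \<Rightarrow> bool"  (infix \<open>\<preceq>\<close> 50) where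
  "a \<preceq> b \<longleftrightarrow> positive (b - a)"

definition cstar_sqrt :: "'a::unital_cstar_algebra \<Rightarrow> 'a" where
  "cstar_sqrt a = (THE b. positive b \<and> b\<^sup>2 = a)"

definition positive_form :: "('a::unital_cstar_algebra \<Rightarrow> complex) \<Rightarrow> bool" where
  "positive_form \<phi> \<longleftrightarrow>
     (\<forall>a b. \<phi> (a + b) = \<phi> a + \<phi> b) \<and> (\<forall>c a. \<phi> (c *\<^sub>C a) = c * \<phi> a) \<and>
     (\<forall>a. positive a \<longrightarrow> \<phi> a \<in> \<real>\<^sub>\<ge>\<^sub>0)"

definition strictly_positive :: "'a::unital_cstar_algebra \<Rightarrow> bool" where
  "strictly_positive a \<longleftrightarrow>
     (\<forall>\<phi>. positive_form \<phi> \<and> \<phi> \<noteq> (\<lambda>_. 0) \<longrightarrow> \<phi> a \<in> \<real> \<and> Re (\<phi> a) > 0)"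

definition central :: "'a::unital_cstar_algebra \<Rightarrow> bool" where
  "central a \<longleftrightarrow> (\<forall>b. a * b = b * a)"


section \<open>Hilbert modules\<close>

text \<open>
  Left modules, with an inner product linear in its first argument.  The algebra is not
  commutative, so the library locale \<^locale>\<open>module\<close> does not apply.  Completeness and the
  norm topology come from the class \<^class>\<open>banach\<close>, tied to the inner product by
  \<open>norm_eq\<close>.
\<close>

definition hmod :: "('h \<Rightarrow> 'h \<Rightarrow> 'a::unital_cstar_algebra) \<Rightarrow> 'h \<Rightarrow> 'a" where
  "hmod ip x = cstar_sqrt (ip x x)"

locale hilbert_module =
  fixes smul :: "'a::unital_cstar_algebra \<Rightarrow> 'h::{complex_normed_vector, banach} \<Rightarrow> 'h"
    and ip :: "'h \<Rightarrow> 'h \<Rightarrow> 'a"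
  assumes smul_add_right: "smul a (x + y) = smul a x + smul a y"
    and smul_add_left: "smul (a + b) x = smul a x + smul b x"
    and smul_smul: "smul a (smul b x) = smul (a * b) x"
    and smul_one: "smul 1 x = x"
    and scaleC_smul_left: "smul (c *\<^sub>C a) x = c *\<^sub>C smul a x"
    and scaleC_smul_right: "smul a (c *\<^sub>C x) = c *\<^sub>C smul a x"
    and ip_add_left: "ip (x + y) z = ip x z + ip y z"
    and ip_smul_left: "ip (smul a x) y = a * ip x y"
    and ip_star: "star (ip x y) = ip y x"
    and ip_positive: "positive (ip x x)"
    and ip_definite: "ip x x = 0 \<Longrightarrow> x = 0"
    and norm_eq: "norm x = norm (hmod ip x)"

definition submodule :: "('a::unital_cstar_algebra \<Rightarrow> 'h::ab_group_add \<Rightarrow> 'h) \<Rightarrow> 'h set \<Rightarrow> bool" where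
  "submodule smul K \<longleftrightarrow>
     0 \<in> K \<and> (\<forall>x\<in>K. \<forall>y\<in>K. x + y \<in> K) \<and> (\<forall>a. \<forall>x\<in>K. smul a x \<in> K)"

definition orth :: "('h \<Rightarrow> 'h \<Rightarrow> 'a::unital_cstar_algebra) \<Rightarrow> 'h set \<Rightarrow> 'h set" where
  "orth ip K = {u. \<forall>x\<in>K. ip u x = 0}"

definition orth_complemented ::
  "('a::unital_cstar_algebra \<Rightarrow> 'h::{complex_normed_vector, banach} \<Rightarrow> 'h) \<Rightarrow>
   ('h \<Rightarrow> 'h \<Rightarrow> 'a) \<Rightarrow> 'h set \<Rightarrow> bool" where
  "orth_complemented smul ip K \<longleftrightarrow>
     submodule smul K \<and> closed K \<and>
     (\<forall>x. \<exists>k\<in>K. \<exists>u\<in>orth ip K. x = k + u) \<and> K \<inter> orth ip K = {0}"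

definition orth_proj ::
  "('h::ab_group_add \<Rightarrow> 'h \<Rightarrow> 'a::unital_cstar_algebra) \<Rightarrow> 'h set \<Rightarrow> 'h \<Rightarrow> 'h" where
  "orth_proj ip K x = (THE k. k \<in> K \<and> x - k \<in> orth ip K)"


section \<open>Operators on a Hilbert module\<close>

definition bounded_operator ::
  "('a::unital_cstar_algebra \<Rightarrow> 'h::{complex_normed_vector, banach} \<Rightarrow> 'h) \<Rightarrow> ('h \<Rightarrow> 'h) \<Rightarrow> bool" where
  "bounded_operator smul T \<longleftrightarrow>
     bounded_linear T \<and> (\<forall>c x. T (c *\<^sub>C x) = c *\<^sub>C T x) \<and> (\<forall>a x. T (smul a x) = smul a (T x))"

definition is_adjoint ::
  "('h \<Rightarrow> 'h \<Rightarrow> 'a::unital_cstar_algebra) \<Rightarrow> ('h \<Rightarrow> 'h) \<Rightarrow> ('h \<Rightarrow> 'h) \<Rightarrow> bool" where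
  "is_adjoint ip T R \<longleftrightarrow> (\<forall>x y. ip (T x) y = ip x (R y))"

definition adjointable ::
  "('a::unital_cstar_algebra \<Rightarrow> 'h::{complex_normed_vector, banach} \<Rightarrow> 'h) \<Rightarrow>
   ('h \<Rightarrow> 'h \<Rightarrow> 'a) \<Rightarrow> ('h \<Rightarrow> 'h) \<Rightarrow> bool" where
  "adjointable smul ip T \<longleftrightarrow> bounded_operator smul T \<and> (\<exists>R. is_adjoint ip T R)"

text \<open>
  The following notions are those of the C*-algebra of adjointable operators: inverses are
  taken within that algebra, and positivity means self-adjoint with spectrum in
  \<open>[0, \<infinity>)\<close>, as for \<^const>\<open>positive\<close>.
\<close>

definition selfadjoint_operator ::
  "('a::unital_cstar_algebra \<Rightarrow> 'h::{complex_normed_vector, banach} \<Rightarrow> 'h) \<Rightarrow>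
   ('h \<Rightarrow> 'h \<Rightarrow> 'a) \<Rightarrow> ('h \<Rightarrow> 'h) \<Rightarrow> bool" where
  "selfadjoint_operator smul ip T \<longleftrightarrow> adjointable smul ip T \<and> is_adjoint ip T T"

definition invertible_operator ::
  "('a::unital_cstar_algebra \<Rightarrow> 'h::{complex_normed_vector, banach} \<Rightarrow> 'h) \<Rightarrow>
   ('h \<Rightarrow> 'h \<Rightarrow> 'a) \<Rightarrow> ('h \<Rightarrow> 'h) \<Rightarrow> bool" where
  "invertible_operator smul ip T \<longleftrightarrow>
     adjointable smul ip T \<and> (\<exists>R. adjointable smul ip R \<and> T \<circ> R = id \<and> R \<circ> T = id)"

definition operator_spectrum ::
  "('a::unital_cstar_algebra \<Rightarrow> 'h::{complex_normed_vector, banach} \<Rightarrow> 'h) \<Rightarrow>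
   ('h \<Rightarrow> 'h \<Rightarrow> 'a) \<Rightarrow> ('h \<Rightarrow> 'h) \<Rightarrow> complex set" where
  "operator_spectrum smul ip T = {c. \<not> invertible_operator smul ip (\<lambda>x. T x - c *\<^sub>C x)}"

definition positive_operator ::
  "('a::unital_cstar_algebra \<Rightarrow> 'h::{complex_normed_vector, banach} \<Rightarrow> 'h) \<Rightarrow>
   ('h \<Rightarrow> 'h \<Rightarrow> 'a) \<Rightarrow> ('h \<Rightarrow> 'h) \<Rightarrow> bool" where
  "positive_operator smul ip T \<longleftrightarrow>
     selfadjoint_operator smul ip T \<and> operator_spectrum smul ip T \<subseteq> \<real>\<^sub>\<ge>\<^sub>0"


section \<open>*-fusion frames\<close>

text \<open>
  Sequences are indexed by the positive integers: the value at \<open>0\<close> is ignored, and a series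
  over \<open>n \<ge> 1\<close> is written as a series over \<^typ>\<open>nat\<close> with \<open>Suc n\<close> in place of \<open>n\<close>.
\<close>

definition weight :: "(nat \<Rightarrow> 'a::unital_cstar_algebra) \<Rightarrow> bool" where
  "weight \<omega> \<longleftrightarrow> (\<forall>n\<ge>1. central (\<omega> n) \<and> strictly_positive (\<omega> n))"

definition star_fusion_frame ::
  "('a::unital_cstar_algebra \<Rightarrow> 'h::{complex_normed_vector, banach} \<Rightarrow> 'h) \<Rightarrow>
   ('h \<Rightarrow> 'h \<Rightarrow> 'a) \<Rightarrow> (nat \<Rightarrow> 'h set) \<Rightarrow> (nat \<Rightarrow> 'a) \<Rightarrow> bool" where
  "star_fusion_frame smul ip H \<omega> \<longleftrightarrow>
     (\<forall>n\<ge>1. orth_complemented smul ip (H n)) \<and> weight \<omega> \<and>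
     (\<forall>x. summable (\<lambda>n. (\<omega> (Suc n))\<^sup>2 * (hmod ip (orth_proj ip (H (Suc n)) x))\<^sup>2)) \<and>
     (\<exists>A B. strictly_positive A \<and> strictly_positive B \<and>
        (\<forall>x. (hmod ip (smul A x))\<^sup>2
               \<preceq> (\<Sum>n. (\<omega> (Suc n))\<^sup>2 * (hmod ip (orth_proj ip (H (Suc n)) x))\<^sup>2) \<and>
             (\<Sum>n. (\<omega> (Suc n))\<^sup>2 * (hmod ip (orth_proj ip (H (Suc n)) x))\<^sup>2)
               \<preceq> (hmod ip (smul B x))\<^sup>2))"

definition frame_operator ::
  "('a::unital_cstar_algebra \<Rightarrow> 'h::{complex_normed_vector, banach} \<Rightarrow> 'h) \<Rightarrow>
   ('h \<Rightarrow> 'h \<Rightarrow> 'a) \<Rightarrow> (nat \<Rightarrow> 'h set) \<Rightarrow> (nat \<Rightarrow> 'a) \<Rightarrow> 'h \<Rightarrow> 'h" where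
  "frame_operator smul ip H \<omega> x = (\<Sum>n. smul ((\<omega> (Suc n))\<^sup>2) (orth_proj ip (H (Suc n)) x))"

end

(* A positive element of a unital C*-algebra is a self-adjoint a with norm (t - a) \<le> t for some
   real t; square roots of such elements come from the binomial series.  With them, every b b* is
   positive, and a Hahn-Banach argument shows that strictly positive elements are self-adjoint and
   invertible.

   For a finite set I of indices let [x, y] be the sum over I of w_n^2 <P_n x, P_n y> and T x the sum
   over I of w_n^2 P_n x.  Then <T x, y> = [x, y], so the Cauchy-Schwarz inequality for [ , ] at the
   pair x, T x gives |T x|^2 \<le> |B|^2 |[x, x]|: the series for S x is Cauchy and S is bounded.  Since A
   is invertible, the lower frame bound gives d |x|^2 \<le> |<S x, x>| in norm.  Hence S - c is bounded
   below for c = 0 and for all c outside [0, \<infinity>), uniformly along a ray on which it is eventually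
   surjective by the contraction principle, and surjectivity can be continued along that ray. *)

theory Submission
  imports Defs
begin

section \<open>Elementary algebra\<close>

text \<open>\<open>strictly_positive\<close> speaks only of values of positive forms, so nothing
  algebraic is known about a weight or a frame bound until enough forms have been constructed; this
  is the purpose of the Hahn-Banach argument. The norm description of positivity is chosen because
  sums and limits of positive elements are easy in it, while they are not in the spectral
  definition.

  The bounds \<open>A\<close> and \<open>B\<close> need not be central. The lower bound therefore
  produces \<open>A * ip x x * star A\<close>, which in general cannot be compared in the order with
  a multiple of \<open>ip x x\<close>; only its norm is usable. This is why the spectrum of the
  frame operator is located by lower bounds in norm. The weights are central, and this makes the
  weighted forms linear over the algebra, so that Cauchy-Schwarz applies to them. The upper bound is
  used twice, at x and at T x; the second use yields a factor |T x|^2 that cancels.\<close>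

lemma star_zero [simp]: "star (0::'a::unital_cstar_algebra) = 0"
  by (metis add_cancel_left_left star_add)

lemma star_minus [simp]: "star (- a) = - star (a::'a::unital_cstar_algebra)"
  by (metis add.right_inverse add_eq_0_iff star_add star_zero)

lemma star_diff: "star (a - b) = star a - star (b::'a::unital_cstar_algebra)"
  using star_add[of a "- b"] by simp

lemma star_scaleR [simp]: "star (r *\<^sub>R a) = r *\<^sub>R star (a::'a::unital_cstar_algebra)"
  by (metis complex_cnj_complex_of_real scaleC_of_real star_scaleC)

lemma star_one [simp]: "star (1::'a::unital_cstar_algebra) = 1"
  by (metis mult_1_right star_mult star_star)

lemma norm_star [simp]: "norm (star a) = norm (a::'a::unital_cstar_algebra)"
proof -
  have le: "norm b \<le> norm (star b)" for b :: 'a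
  proof (cases "norm b = 0")
    case False
    have "norm b * norm b \<le> norm (star b) * norm b"
      using cstar_identity[of b] norm_mult_ineq[of "star b" b] by (simp add: power2_eq_square)
    then show ?thesis using False by simp
  qed simp
  show ?thesis using le[of a] le[of "star a"] by (simp add: star_star)
qed

lemma bounded_linear_star: "bounded_linear (star :: 'a::unital_cstar_algebra \<Rightarrow> 'a)"
  by (rule bounded_linear_intro[where K=1]) (simp_all add: star_add)

lemma norm_one_le: "norm (1::'a::unital_cstar_algebra) \<le> 1"
proof -
  have "norm (1::'a) = (norm (1::'a))\<^sup>2"
    using cstar_identity[of "1::'a"] by simp
  then show ?thesis by (cases "norm (1::'a) = 0") (auto simp: power2_eq_square)
qed

lemma norm_mult_self: "star a = a \<Longrightarrow> norm (a * a) = (norm a)\<^sup>2" for a :: "'a::unital_cstar_algebra"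
  by (metis cstar_identity)

lemma mult_self_eq_zero: "star a = a \<Longrightarrow> a * a = 0 \<Longrightarrow> a = 0" for a :: "'a::unital_cstar_algebra"
  using norm_mult_self[of a] by simp

lemma norm_power_le_one: "norm a \<le> 1 \<Longrightarrow> norm (a ^ n) \<le> 1" for a :: "'a::unital_cstar_algebra"
proof (induction n)
  case (Suc n)
  have "norm (a ^ Suc n) \<le> norm a * norm (a ^ n)" by (simp add: norm_mult_ineq)
  also have "\<dots> \<le> 1" using Suc by (simp add: mult_le_one)
  finally show ?case .
qed (simp add: norm_one_le)

lemma scaleC_one_mult: "(c *\<^sub>C 1) * a = c *\<^sub>C a" "a * (c *\<^sub>C 1) = c *\<^sub>C (a::'a::unital_cstar_algebra)"
  by (simp_all add: scaleC_mult_left scaleC_mult_right)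

lemma scaleC_zero_left [simp]: "0 *\<^sub>C x = (0::'a::complex_normed_vector)"
  using norm_scaleC[of 0 x] by simp

lemma scaleC_one [simp]: "1 *\<^sub>C x = (x::'a::complex_normed_vector)"
  using scaleC_of_real[of 1 x] by simp

lemma scaleC_minus_left: "(- c) *\<^sub>C x = - (c *\<^sub>C (x::'a::complex_normed_vector))"
  by (metis add.right_inverse add_eq_0_iff scaleC_add_left scaleC_zero_left)

lemma scaleC_zero_right [simp]: "c *\<^sub>C 0 = (0::'a::complex_normed_vector)"
  using norm_scaleC[of c "0::'a"] by simp

lemma scaleC_minus_right: "c *\<^sub>C (- x) = - (c *\<^sub>C (x::'a::complex_normed_vector))"
  by (metis add.right_inverse add_eq_0_iff scaleC_add_right scaleC_zero_right)

lemma scaleC_diff_right: "c *\<^sub>C (x - y) = c *\<^sub>C x - c *\<^sub>C (y::'a::complex_normed_vector)"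
  using scaleC_add_right[of c x "- y"] by (simp add: scaleC_minus_right)

lemma scaleC_scaleR: "c *\<^sub>C (r *\<^sub>R x) = r *\<^sub>R (c *\<^sub>C (x::'a::complex_normed_vector))"
  by (metis mult.commute scaleC_of_real scaleC_scaleC)

lemma bounded_linear_scaleC: "bounded_linear (\<lambda>x::'a::complex_normed_vector. c *\<^sub>C x)"
  by (rule bounded_linear_intro[where K="cmod c"])
     (simp_all add: scaleC_add_right scaleC_scaleR norm_scaleC)


section \<open>Square roots\<close>

text \<open>The Taylor coefficients of \<open>sqrt (1 - x)\<close>.\<close>

definition sqrt_coeff :: "nat \<Rightarrow> real" where
  "sqrt_coeff n = (1/2 gchoose n) * (-1) ^ n"

lemma sqrt_coeff_0 [simp]: "sqrt_coeff 0 = 1"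
  by (simp add: sqrt_coeff_def)

text \<open>In the Pochhammer product starting at -1/2 only the first factor is negative.\<close>

lemma sqrt_coeff_Suc_le: "sqrt_coeff (Suc n) \<le> 0"
proof -
  have "sqrt_coeff (Suc n) = pochhammer (-1/2) (Suc n) / fact (Suc n)"
    by (simp add: sqrt_coeff_def gbinomial_pochhammer flip: power_mult_distrib)
  also have "\<dots> = - (1/2) * pochhammer (1/2) n / fact (Suc n)"
    by (simp add: pochhammer_rec)
  also have "\<dots> \<le> 0"
    by (simp add: pochhammer_nonneg divide_nonpos_pos)
  finally show ?thesis .
qed

text \<open>Partial sums are the coefficients of (1 - x)^(1/2) / (1 - x) = (1 - x)^(-1/2), which are
  nonnegative.\<close>

lemma sum_sqrt_coeff_nonneg: "0 \<le> (\<Sum>k\<le>n. sqrt_coeff k)"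
proof -
  have "(\<Sum>k\<le>n. sqrt_coeff k) = (-1) ^ n * (-1/2 gchoose n)"
    unfolding sqrt_coeff_def by (subst gbinomial_sum_lower_neg) simp
  also have "\<dots> = pochhammer (1/2) n / fact n"
    by (simp add: gbinomial_pochhammer flip: power_mult_distrib)
  also have "\<dots> \<ge> 0" by (simp add: pochhammer_nonneg)
  finally show ?thesis .
qed

text \<open>All coefficients after the leading 1 have one sign, so the absolute sum telescopes to 1
  minus a partial sum. Absolute summability at radius 1 allows the series to be evaluated at
  elements of norm exactly 1.\<close>

lemma sum_abs_sqrt_coeff_le: "(\<Sum>k<n. \<bar>sqrt_coeff (Suc k)\<bar>) \<le> 1"
proof -
  have "(\<Sum>k<n. \<bar>sqrt_coeff (Suc k)\<bar>) = - (\<Sum>k<n. sqrt_coeff (Suc k))"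
    by (simp add: sqrt_coeff_Suc_le sum_negf)
  also have "\<dots> = 1 - (\<Sum>k\<le>n. sqrt_coeff k)"
    by (simp add: sum.atMost_shift)
  finally show ?thesis using sum_sqrt_coeff_nonneg[of n] by simp
qed

lemma summable_abs_sqrt_coeff_Suc: "summable (\<lambda>n. \<bar>sqrt_coeff (Suc n)\<bar>)"
  by (rule bounded_imp_summable[where B=1])
     (use sum_abs_sqrt_coeff_le[of "Suc n" for n] in \<open>auto simp: lessThan_Suc_atMost\<close>)

text \<open>These are the coefficients of the square of sqrt (1 - x), that is, of 1 - x; the
  computation is Vandermonde's identity for 1/2 + 1/2.\<close>

lemma sqrt_coeff_convolution:
  "(\<Sum>k\<le>n. sqrt_coeff k * sqrt_coeff (n - k)) = (if n = 0 then 1 else if n = 1 then -1 else 0)"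
proof -
  have "(\<Sum>k\<le>n. sqrt_coeff k * sqrt_coeff (n - k))
      = (\<Sum>k\<le>n. (1/2 gchoose k) * (1/2 gchoose (n - k))) * (-1) ^ n"
    unfolding sum_distrib_right
    by (intro sum.cong) (auto simp: sqrt_coeff_def simp flip: power_add)
  also have "\<dots> = (1 gchoose n) * (-1) ^ n"
    using gbinomial_Vandermonde[of "1/2::real" "1/2" n] by (simp add: atMost_atLeast0)
  also have "(1 gchoose n) = real (1 choose n)"
    by (metis binomial_gbinomial of_nat_1)
  finally show ?thesis
    by (cases "n \<le> 1") (auto simp: binomial_eq_0 le_Suc_eq)
qed

text \<open>The root is the series of sqrt (1 - x) at x = 1 - a. Being a limit of polynomials in
  \<open>a\<close>, it commutes with everything that \<open>a\<close> commutes with; the bound on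
  \<open>1 - y\<close> makes it positive.\<close>

lemma sqrt_unit:
  fixes a :: "'a::unital_cstar_algebra"
  assumes sa: "star a = a" and n: "norm (1 - a) \<le> 1"
  obtains y where "star y = y" "y * y = a" "norm (1 - y) \<le> 1"
    "\<And>b. a * b = b * a \<Longrightarrow> y * b = b * y"
proof -
  define x where "x = 1 - a"
  define f where "f n = sqrt_coeff n *\<^sub>R x ^ n" for n
  define y where "y = suminf f"
  have nx: "norm (x ^ n) \<le> 1" for n
    using n norm_power_le_one unfolding x_def by blast
  have nf: "norm (f n) \<le> \<bar>sqrt_coeff n\<bar>" for n
    unfolding f_def using nx[of n] by (simp add: mult_left_le)
  have sc: "summable (\<lambda>n. \<bar>sqrt_coeff n\<bar>)"
    using summable_abs_sqrt_coeff_Suc summable_Suc_iff[of "\<lambda>n. \<bar>sqrt_coeff n\<bar>"] by blast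
  have sn: "summable (\<lambda>n. norm (f n))"
    by (rule summable_comparison_test[OF _ sc]) (use nf in auto)
  then have sf: "summable f" by (rule summable_norm_cancel)
  have xc: "star (x ^ n) = x ^ n" for n
    by (induction n) (auto simp: star_mult x_def sa star_diff simp flip: power_commutes)
  have "star y = (\<Sum>n. star (f n))"
    unfolding y_def by (rule bounded_linear.suminf[OF bounded_linear_star sf])
  moreover have "star (f n) = f n" for n by (simp add: f_def xc)
  ultimately have 1: "star y = y" by (simp add: y_def)
  have "(\<lambda>k. \<Sum>i\<le>k. f i * f (k - i)) sums (y * y)"
    unfolding y_def by (rule Cauchy_product_sums[OF sn sn])
  moreover have "(\<Sum>i\<le>k. f i * f (k - i)) =
      (if k = 0 then 1 else if k = 1 then - x else 0)" for k
  proof -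
    have "(\<Sum>i\<le>k. f i * f (k - i)) = (\<Sum>i\<le>k. sqrt_coeff i * sqrt_coeff (k - i)) *\<^sub>R x ^ k"
      unfolding scaleR_sum_left by (intro sum.cong) (auto simp: f_def simp flip: power_add)
    then show ?thesis by (simp add: sqrt_coeff_convolution)
  qed
  ultimately have "(\<lambda>k. if k = 0 then 1 else if k = 1 then - x else 0) sums (y * y)"
    by simp
  moreover have "(\<lambda>k. if k = 0 then 1 else if k = 1 then - x else 0) sums
      (\<Sum>k\<in>{0,1::nat}. if k = 0 then 1 else if k = 1 then - x else 0)"
    by (rule sums_finite) auto
  ultimately have 2: "y * y = a"
    by (auto simp: x_def dest: sums_unique2)
  have sS: "summable (\<lambda>n. norm (f (Suc n)))" using sn summable_Suc_iff[of "\<lambda>n. norm (f n)"] by blast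
  have "1 - y = - (\<Sum>n. f (Suc n))"
    unfolding y_def using suminf_split_head[OF sf] by (simp add: f_def)
  then have "norm (1 - y) \<le> (\<Sum>n. norm (f (Suc n)))"
    using summable_norm[OF sS] by simp
  also have "\<dots> \<le> (\<Sum>n. \<bar>sqrt_coeff (Suc n)\<bar>)"
    by (rule suminf_le[OF nf sS summable_abs_sqrt_coeff_Suc])
  also have "\<dots> \<le> 1"
    by (rule suminf_le_const[OF summable_abs_sqrt_coeff_Suc sum_abs_sqrt_coeff_le])
  finally have 3: "norm (1 - y) \<le> 1" .
  have 4: "y * b = b * y" if "a * b = b * a" for b
  proof -
    have xb: "x * b = b * x" unfolding x_def using that by (simp add: algebra_simps)
    have "x ^ n * b = b * x ^ n" for n
    proof (induction n)
      case (Suc n)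
      then show ?case by (metis mult.assoc power_Suc xb)
    qed simp
    then have "f n * b = b * f n" for n by (simp add: f_def)
    then show ?thesis
      unfolding y_def suminf_mult[OF sf, symmetric] suminf_mult2[OF sf] by simp
  qed
  from that[OF 1 2 3 4] show thesis .
qed


section \<open>The positive cone\<close>

text \<open>The positive elements, described by the norm alone; \<open>positive_iff\<close> gives the agreement with
  the spectral description.\<close>

definition pos_cone :: "'a::unital_cstar_algebra set" where
  "pos_cone = {a. star a = a \<and> (\<exists>t. norm (t *\<^sub>R 1 - a) \<le> t)}"

lemma pos_coneI: "star a = a \<Longrightarrow> norm (t *\<^sub>R 1 - a) \<le> t \<Longrightarrow> a \<in> pos_cone"
  by (auto simp: pos_cone_def)

lemma pos_cone_star: "a \<in> pos_cone \<Longrightarrow> star a = a"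
  by (simp add: pos_cone_def)

text \<open>The radii add, by the triangle inequality. For spectra the corresponding fact is not
  immediate.\<close>

lemma pos_cone_add:
  assumes "a \<in> pos_cone" "b \<in> pos_cone" shows "a + b \<in> pos_cone"
proof -
  obtain s t where st: "norm (s *\<^sub>R 1 - a) \<le> s" "norm (t *\<^sub>R 1 - b) \<le> t"
    using assms by (auto simp: pos_cone_def)
  have "(s + t) *\<^sub>R 1 - (a + b) = (s *\<^sub>R 1 - a) + (t *\<^sub>R 1 - b)" by (simp add: algebra_simps)
  then have "norm ((s + t) *\<^sub>R 1 - (a + b)) \<le> s + t" using st norm_triangle_le by (metis add_mono)
  then show ?thesis using assms by (intro pos_coneI) (auto simp: star_add pos_cone_star)
qed

lemma pos_cone_scaleR:
  assumes "a \<in> pos_cone" "0 \<le> r" shows "r *\<^sub>R a \<in> pos_cone"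
proof -
  obtain t where t: "norm (t *\<^sub>R 1 - a) \<le> t" using assms by (auto simp: pos_cone_def)
  have "(r * t) *\<^sub>R 1 - r *\<^sub>R a = r *\<^sub>R (t *\<^sub>R 1 - a)" by (simp add: algebra_simps)
  then have "norm ((r * t) *\<^sub>R 1 - r *\<^sub>R a) \<le> r * t" using t assms(2) by (simp add: mult_left_mono)
  then show ?thesis using assms by (intro pos_coneI) (auto simp: pos_cone_star)
qed

lemma pos_cone_scalar: "0 \<le> r \<Longrightarrow> r *\<^sub>R 1 \<in> pos_cone"
  by (rule pos_coneI[of _ r]) auto

lemma pos_cone_zero: "0 \<in> pos_cone"
  using pos_cone_scalar[of 0] by simp

lemma norm_minus_pos_cone: "star a = a \<Longrightarrow> norm a \<le> M \<Longrightarrow> M *\<^sub>R 1 - a \<in> pos_cone"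
  by (rule pos_coneI[of _ M]) (auto simp: star_diff)

lemma norm_plus_pos_cone: "star a = a \<Longrightarrow> norm a \<le> M \<Longrightarrow> M *\<^sub>R 1 + a \<in> pos_cone"
  using norm_minus_pos_cone[of "-a" M] by simp

text \<open>Division by the radius \<open>t\<close> reduces to \<open>sqrt_unit\<close>; radius 0
  forces \<open>a = 0\<close>.\<close>

lemma pos_cone_sqrt:
  assumes "a \<in> pos_cone"
  obtains y where "y \<in> pos_cone" "y * y = a" "\<And>b. a * b = b * a \<Longrightarrow> y * b = b * y"
proof -
  obtain t where t: "norm (t *\<^sub>R 1 - a) \<le> t" using assms by (auto simp: pos_cone_def)
  show thesis
  proof (cases "t = 0")
    case True
    with t have "a = 0" by simp
    then show thesis using that[of 0] pos_cone_zero by simp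
  next
    case False
    then have tp: "t > 0" using t norm_ge_zero[of "t *\<^sub>R 1 - a"] by linarith
    define a' where "a' = (1/t) *\<^sub>R a"
    have "1 - a' = (1/t) *\<^sub>R (t *\<^sub>R 1 - a)" using tp by (simp add: a'_def algebra_simps)
    then have "norm (1 - a') \<le> 1" using t tp by (simp add: divide_simps)
    moreover have "star a' = a'" by (simp add: a'_def pos_cone_star[OF assms])
    ultimately obtain y where y: "star y = y" "y * y = a'" "norm (1 - y) \<le> 1"
      "\<And>b. a' * b = b * a' \<Longrightarrow> y * b = b * y" using sqrt_unit by blast
    have "sqrt t *\<^sub>R y \<in> pos_cone"
      using y(1,3) tp by (intro pos_cone_scaleR pos_coneI[of _ 1]) auto
    moreover have "(sqrt t *\<^sub>R y) * (sqrt t *\<^sub>R y) = a" using tp by (simp add: y(2) a'_def)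
    moreover have "(sqrt t *\<^sub>R y) * b = b * (sqrt t *\<^sub>R y)" if "a * b = b * a" for b
      using y(4)[of b] that by (simp add: a'_def)
    ultimately show thesis using that by blast
  qed
qed

text \<open>The element \<open>z + \<i>w\<close> is unitary and \<open>z\<close> is its real part.\<close>

lemma norm_le_one_of_sum_squares:
  fixes z w :: "'a::unital_cstar_algebra"
  assumes "star z = z" "star w = w" "z * w = w * z" "z * z + w * w = 1"
  shows "norm z \<le> 1"
proof -
  define u where "u = z + \<i> *\<^sub>C w"
  have su: "star u = z - \<i> *\<^sub>C w"
    using assms by (simp add: u_def star_add star_scaleC scaleC_minus_left)
  have "star u * u = 1"
    unfolding su using assms
    by (simp add: u_def algebra_simps scaleC_mult_left scaleC_mult_right scaleC_scaleC
        scaleC_minus_left scaleC_diff_right)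
  then have "(norm u)\<^sup>2 \<le> 1" using cstar_identity[of u] norm_one_le by metis
  then have nu: "norm u \<le> 1" by (simp add: power_le_one_iff)
  have "2 *\<^sub>R z = u + star u" unfolding su by (simp add: u_def scaleR_2)
  then have "norm (2 *\<^sub>R z) \<le> norm u + norm (star u)" by (metis norm_triangle_ineq)
  then show ?thesis using nu by simp
qed

text \<open>The element to be bounded is the root \<open>w\<close> of \<open>1 - z * z\<close>: the
  squares of \<open>w\<close> and \<open>z\<close> sum to 1, so \<open>norm w \<le> 1\<close> by the
  unitary argument.\<close>

lemma norm_one_minus_square_le:
  fixes z :: "'a::unital_cstar_algebra"
  assumes "star z = z" "norm (z * z) \<le> 1"
  shows "norm (1 - z * z) \<le> 1"
proof -
  have "star (1 - z * z) = 1 - z * z" using assms by (simp add: star_diff star_mult)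
  moreover have "norm (1 - (1 - z * z)) \<le> 1" using assms by simp
  ultimately obtain w where w: "star w = w" "w * w = 1 - z * z"
    "\<And>b. (1 - z * z) * b = b * (1 - z * z) \<Longrightarrow> w * b = b * w" using sqrt_unit by blast
  have "w * z = z * w" using w(3)[of z] by (simp add: algebra_simps mult.assoc)
  then have "norm w \<le> 1"
    using norm_le_one_of_sum_squares[of w z] assms w(1,2) by simp
  then show ?thesis using norm_mult_self[OF w(1)] w(2) by (metis norm_ge_zero power_le_one)
qed

lemma norm_scalar_minus_square_le:
  fixes y :: "'a::unital_cstar_algebra"
  assumes "star y = y" "norm (y * y) \<le> M"
  shows "norm (M *\<^sub>R 1 - y * y) \<le> M"
proof (cases "M = 0")
  case True
  then show ?thesis using assms by simp
next
  case False
  then have M: "M > 0" using assms norm_ge_zero[of "y * y"] by linarith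
  define z where "z = (1 / sqrt M) *\<^sub>R y"
  have zz: "z * z = (1/M) *\<^sub>R (y * y)" using M by (simp add: z_def)
  have "norm (1 - z * z) \<le> 1"
    by (rule norm_one_minus_square_le) (use assms M in \<open>auto simp: zz z_def divide_simps\<close>)
  moreover have "M *\<^sub>R 1 - y * y = M *\<^sub>R (1 - z * z)"
    using M by (simp add: zz algebra_simps)
  ultimately show ?thesis using M by (simp add: mult_left_le)
qed

lemma pos_cone_square: "star y = y \<Longrightarrow> y * y \<in> pos_cone"
  by (rule pos_coneI[OF _ norm_scalar_minus_square_le]) (auto simp: star_mult)

text \<open>Since \<open>a\<close> is a square, the radius in the definition of the cone may be any
  bound for the norm of \<open>a\<close>.\<close>

lemma norm_scalar_minus_le:
  assumes "a \<in> pos_cone" "norm a \<le> M" shows "norm (M *\<^sub>R 1 - a) \<le> M"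
  using norm_scalar_minus_square_le pos_cone_sqrt[OF assms(1)] assms(2) pos_cone_star by metis

text \<open>Fixing the radius as \<open>norm a\<close> removes the existential quantifier and leaves
  closed conditions only.\<close>

lemma closed_pos_cone: "closed (pos_cone :: 'a::unital_cstar_algebra set)"
proof -
  have "pos_cone = {a::'a. star a = a \<and> norm (norm a *\<^sub>R 1 - a) \<le> norm a}"
    by (auto simp: pos_cone_star norm_scalar_minus_le intro: pos_coneI)
  moreover have "closed {a::'a. star a = a \<and> norm (norm a *\<^sub>R 1 - a) \<le> norm a}"
    by (intro closed_Collect_conj closed_Collect_eq closed_Collect_le continuous_intros
        bounded_linear.continuous_on[OF bounded_linear_star])
  ultimately show ?thesis by simp
qed

lemma square_mult_commute: "a * b = b * a \<Longrightarrow> a * a * b = b * (a * a)"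
  for a b :: "'a::semigroup_mult"
  by (metis mult.assoc)

lemma pos_cone_mult_commute:
  assumes "a \<in> pos_cone" "b \<in> pos_cone" "a * b = b * a" shows "a * b \<in> pos_cone"
proof -
  obtain y where y: "y \<in> pos_cone" "y * y = a" "\<And>c. a * c = c * a \<Longrightarrow> y * c = c * y"
    using pos_cone_sqrt[OF assms(1)] by blast
  obtain z where z: "z \<in> pos_cone" "z * z = b" "\<And>c. b * c = c * b \<Longrightarrow> z * c = c * z"
    using pos_cone_sqrt[OF assms(2)] by blast
  \<comment> \<open>Commutation is passed on twice: \<open>b\<close> commutes with \<open>a\<close>,
    hence with its root \<open>y\<close>; then \<open>y\<close> commutes with \<open>b\<close>,
    hence with its root \<open>z\<close>.\<close>
  have yz: "y * z = z * y" using y(3)[of b] z(3)[of y] assms(3) by simp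
  have "a * b = (y * z) * (y * z)"
    using yz y(2) z(2) by (metis mult.assoc)
  moreover have "star (y * z) = y * z"
    using yz y(1) z(1) by (simp add: star_mult pos_cone_star)
  ultimately show ?thesis using pos_cone_square by metis
qed

text \<open>After scaling, \<open>1 - z'\<close> and \<open>1 + z'\<close> are commuting positive
  elements, so \<open>1 - z' * z'\<close> has a root \<open>w\<close>, and \<open>z'\<close> is the
  real part of a unitary.\<close>

lemma norm_le_of_pos_cone:
  fixes z :: "'a::unital_cstar_algebra"
  assumes sa: "star z = z" and M: "0 \<le> M"
    and le: "M *\<^sub>R 1 - z \<in> pos_cone" and ge: "M *\<^sub>R 1 + z \<in> pos_cone"
  shows "norm z \<le> M"
proof (rule field_le_epsilon)
  fix e :: real assume e: "0 < e"
  \<comment> \<open>The summand \<open>e\<close> allows division by \<open>N\<close> even when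
    \<open>M = 0\<close>.\<close>
  define N where "N = M + e"
  have N: "N > 0" using M e by (simp add: N_def)
  have le': "N *\<^sub>R 1 - z \<in> pos_cone" and ge': "N *\<^sub>R 1 + z \<in> pos_cone"
    using pos_cone_add[OF le pos_cone_scalar[of e]] pos_cone_add[OF ge pos_cone_scalar[of e]] e
    by (simp_all add: N_def algebra_simps)
  define z' where "z' = (1/N) *\<^sub>R z"
  have "1 - z' = (1/N) *\<^sub>R (N *\<^sub>R 1 - z)" "1 + z' = (1/N) *\<^sub>R (N *\<^sub>R 1 + z)"
    using N by (simp_all add: z'_def algebra_simps)
  then have "1 - z' \<in> pos_cone" "1 + z' \<in> pos_cone"
    using le' ge' N by (metis pos_cone_scaleR divide_nonneg_pos zero_le_one)+
  then have "(1 - z') * (1 + z') \<in> pos_cone"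
    by (rule pos_cone_mult_commute) (simp add: algebra_simps)
  moreover have "(1 - z') * (1 + z') = 1 - z' * z'" by (simp add: algebra_simps)
  ultimately obtain w where w: "w \<in> pos_cone" "w * w = 1 - z' * z'"
    "\<And>b. (1 - z' * z') * b = b * (1 - z' * z') \<Longrightarrow> w * b = b * w"
    using pos_cone_sqrt by metis
  have "w * z' = z' * w" using w(3)[of z'] by (simp add: algebra_simps mult.assoc)
  then have "norm z' \<le> 1"
    by (intro norm_le_one_of_sum_squares[of z' w])
       (simp_all add: w(2) pos_cone_star[OF w(1)], simp add: z'_def sa)
  then show "norm z \<le> M + e" using N by (simp add: z'_def N_def[symmetric] divide_simps)
qed

lemma pos_cone_antisym:
  assumes "a \<in> pos_cone" "- a \<in> pos_cone" shows "a = 0"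
  using norm_le_of_pos_cone[of a 0] assms by (simp add: pos_cone_star)

text \<open>Because a \<le> b \<le> \<open>norm b\<close>, while the lower bound for
  \<open>a\<close> is clear from its positivity.\<close>

lemma norm_mono_pos_cone:
  assumes a: "a \<in> pos_cone" and ab: "b - a \<in> pos_cone" shows "norm a \<le> norm b"
proof (rule norm_le_of_pos_cone)
  have "b \<in> pos_cone" using pos_cone_add[OF a ab] by simp
  then have "norm b *\<^sub>R 1 - b \<in> pos_cone" by (simp add: norm_minus_pos_cone pos_cone_star)
  from pos_cone_add[OF this ab] show "norm b *\<^sub>R 1 - a \<in> pos_cone" by simp
  show "norm b *\<^sub>R 1 + a \<in> pos_cone" by (simp add: a pos_cone_add pos_cone_scalar)
qed (use a in \<open>auto simp: pos_cone_star\<close>)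

lemma pos_cone_sum_zero:
  assumes "a \<in> pos_cone" "b \<in> pos_cone" "a + b = 0" shows "a = 0"
  using assms by (metis add_eq_0_iff pos_cone_antisym)


section \<open>Invertibility and the spectrum\<close>

lemma alg_invertibleI:
  assumes "x * y = 1" "y' * x = 1" shows "alg_invertible (x::'a::unital_cstar_algebra)"
proof -
  have "y' = y' * (x * y)" by (simp add: assms)
  also have "\<dots> = y" using mult.assoc[of y' x y] assms by simp
  finally show ?thesis using assms by (auto simp: alg_invertible_def)
qed

lemma alg_invertible_factor:
  assumes "alg_invertible (x * y)" "x * y = y * x" shows "alg_invertible (x::'a::unital_cstar_algebra)"
proof -
  obtain d where d: "x * y * d = 1" "d * (x * y) = 1"
    using assms by (auto simp: alg_invertible_def)
  show ?thesis
  proof (rule alg_invertibleI)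
    show "x * (y * d) = 1" by (metis d(1) mult.assoc)
    show "(d * y) * x = 1" by (metis assms(2) d(2) mult.assoc)
  qed
qed

lemma alg_invertible_scaleR:
  assumes "alg_invertible x" "r \<noteq> 0" shows "alg_invertible (r *\<^sub>R (x::'a::unital_cstar_algebra))"
proof -
  obtain d where d: "x * d = 1" "d * x = 1"
    using assms by (auto simp: alg_invertible_def)
  show ?thesis
    by (rule alg_invertibleI[of _ "(1/r) *\<^sub>R d" "(1/r) *\<^sub>R d"]) (use d assms(2) in auto)
qed

lemma alg_invertible_one_minus:
  fixes x :: "'a::unital_cstar_algebra"
  assumes "norm x < 1" shows "alg_invertible (1 - x)"
proof -
  have np: "norm (x ^ n) \<le> norm x ^ n" for n
  proof (induction n)
    case (Suc n)
    have "norm (x ^ Suc n) \<le> norm x * norm (x ^ n)" by (simp add: norm_mult_ineq)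
    also have "\<dots> \<le> norm x * norm x ^ n" using Suc by (simp add: mult_left_mono)
    finally show ?case by simp
  qed (simp add: norm_one_le)
  have "summable (\<lambda>n. norm x ^ n)" using assms by (simp add: summable_geometric)
  then have s: "summable (\<lambda>n. x ^ n)"
    by (rule summable_comparison_test[rotated]) (use np in auto)
  define y where "y = (\<Sum>n. x ^ n)"
  have "(\<Sum>n. x ^ Suc n) = y - 1" using suminf_split_head[OF s] by (simp add: y_def)
  moreover have "(\<Sum>n. x ^ Suc n) = x * y" using suminf_mult[OF s, of x] by (simp add: y_def)
  moreover have "(\<Sum>n. x ^ Suc n) = y * x"
    using suminf_mult2[OF s, of x] by (simp add: y_def power_commutes)
  ultimately show ?thesis
    by (intro alg_invertibleI[of _ y y]) (auto simp: algebra_simps)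
qed

text \<open>A Neumann series: \<open>t *\<^sub>R 1 - a\<close> has norm at most \<open>t\<close>,
  hence norm below 1 after division by \<open>t + s\<close>.\<close>

lemma pos_cone_shift_invertible:
  fixes a :: "'a::unital_cstar_algebra"
  assumes "a \<in> pos_cone" "0 < s" shows "alg_invertible (a + s *\<^sub>R 1)"
proof -
  obtain t where t: "norm (t *\<^sub>R 1 - a) \<le> t" using assms by (auto simp: pos_cone_def)
  then have t0: "t \<ge> 0" using norm_ge_zero order_trans by blast
  define x where "x = (1 / (t + s)) *\<^sub>R (t *\<^sub>R 1 - a)"
  have "norm x < 1" using t t0 assms(2) by (simp add: x_def divide_simps)
  moreover have "a + s *\<^sub>R 1 = (t + s) *\<^sub>R (1 - x)"
    using t0 assms(2) by (simp add: x_def scaleR_diff_right) (simp add: algebra_simps)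
  ultimately show ?thesis
    using alg_invertible_scaleR[OF alg_invertible_one_minus[of x], of "t + s"] t0 assms(2) by simp
qed

lemma pos_cone_invertible_minus:
  fixes b :: "'a::unital_cstar_algebra"
  assumes b: "b \<in> pos_cone" and "alg_invertible b"
  obtains e where "e > 0" "b - e *\<^sub>R 1 \<in> pos_cone"
proof -
  obtain c where c: "b * c = 1" "c * b = 1" using assms by (auto simp: alg_invertible_def)
  have "star c = star c * (b * c)" by (simp add: c)
  also have "\<dots> = star (b * c) * c" by (simp add: star_mult pos_cone_star[OF b] mult.assoc)
  finally have sc: "star c = c" by (simp add: c)
  \<comment> \<open>Chosen so that \<open>e *\<^sub>R c\<close> has norm at most 1; then
    \<open>b * (1 - e *\<^sub>R c) = b - e *\<^sub>R 1\<close> is a product of commuting positive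
    elements.\<close>
  define e where "e = 1 / (norm c + 1)"
  have e: "e > 0" by (simp add: e_def add_nonneg_pos)
  have "norm (e *\<^sub>R c) \<le> 1" by (simp add: e_def divide_le_eq_1 add_nonneg_pos)
  then have "1 - e *\<^sub>R c \<in> pos_cone"
    by (intro pos_coneI[of _ 1]) (auto simp: sc star_diff)
  from pos_cone_mult_commute[OF b this] have "b - e *\<^sub>R 1 \<in> pos_cone"
    by (simp add: algebra_simps c)
  with e show thesis using that by blast
qed

text \<open>The least \<open>s \<ge> 0\<close> with \<open>a + s \<in> pos_cone\<close> must be \<open>0\<close>: at a positive \<open>s\<close> the invertible
  element \<open>a + s\<close> would leave room to decrease it.\<close>

lemma pos_cone_of_shifts_invertible:
  fixes a :: "'a::unital_cstar_algebra"
  assumes sa: "star a = a" and inv: "\<And>s. s > 0 \<Longrightarrow> alg_invertible (a + s *\<^sub>R 1)"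
  shows "a \<in> pos_cone"
proof -
  define S where "S = {s. 0 \<le> s \<and> a + s *\<^sub>R 1 \<in> pos_cone}"
  have "closed ({0..} \<inter> (\<lambda>s. a + s *\<^sub>R 1) -` pos_cone)"
    by (intro closed_Int closed_atLeast continuous_closed_vimage[OF closed_pos_cone]) 
       (auto intro!: continuous_intros)
  moreover have "S = {0..} \<inter> (\<lambda>s. a + s *\<^sub>R 1) -` pos_cone" by (auto simp: S_def)
  ultimately have "closed S" by simp
  have "norm a \<in> S" using norm_plus_pos_cone[OF sa order_refl] by (simp add: S_def add.commute)
  have bd: "bdd_below S" by (auto simp: S_def bdd_below_def)
  define s where "s = Inf S"
  have "s \<in> S" unfolding s_def
    by (rule closed_contains_Inf) (use \<open>norm a \<in> S\<close> \<open>closed S\<close> bd in auto)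
  then have s0: "0 \<le> s" and sP: "a + s *\<^sub>R 1 \<in> pos_cone" by (auto simp: S_def)
  show ?thesis
  proof (cases "s = 0")
    case True
    then show ?thesis using sP by simp
  next
    case False
    then have "s > 0" using s0 by simp
    obtain e where e: "e > 0" "a + s *\<^sub>R 1 - e *\<^sub>R 1 \<in> pos_cone"
      using pos_cone_invertible_minus[OF sP inv[OF \<open>s > 0\<close>]] by blast
    \<comment> \<open>The minimum with \<open>s\<close> keeps \<open>s - d\<close> nonnegative, as
      membership in \<open>S\<close> requires.\<close>
    define d where "d = min e s"
    have "(a + s *\<^sub>R 1 - e *\<^sub>R 1) + (e - d) *\<^sub>R 1 \<in> pos_cone"
      by (intro pos_cone_add e pos_cone_scalar) (simp add: d_def)
    moreover have "(a + s *\<^sub>R 1 - e *\<^sub>R 1) + (e - d) *\<^sub>R 1 = a + (s - d) *\<^sub>R 1"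
      by (simp add: algebra_simps)
    ultimately have "a + (s - d) *\<^sub>R 1 \<in> pos_cone" by (simp only:)
    then have "s - d \<in> S" by (simp add: S_def) (simp add: d_def)
    then have "s \<le> s - d" unfolding s_def using bd cInf_lower by metis
    then show ?thesis using e \<open>s > 0\<close> by (simp add: d_def)
  qed
qed

text \<open>Only the spectral points on the negative axis matter from left to right. Conversely a
  negative \<open>c\<close> is a shift by a positive scalar, and a nonreal \<open>c\<close> is
  excluded by multiplying with a conjugate factor.\<close>

lemma positive_iff: "positive a \<longleftrightarrow> a \<in> pos_cone" for a :: "'a::unital_cstar_algebra"
proof
  assume pos: "positive a"
  show "a \<in> pos_cone"
  proof (rule pos_cone_of_shifts_invertible)
    show "star a = a" using pos by (simp add: positive_def)
    fix s :: real assume "s > 0"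
    then have "complex_of_real (- s) \<notin> \<real>\<^sub>\<ge>\<^sub>0" by (simp add: complex_nonneg_Reals_iff)
    then have "alg_invertible (a - complex_of_real (- s) *\<^sub>C 1)"
      using pos by (auto simp: positive_def alg_spectrum_def)
    then show "alg_invertible (a + s *\<^sub>R 1)" by (simp only: scaleC_of_real) simp
  qed
next
  assume P: "a \<in> pos_cone"
  have "alg_invertible (a - c *\<^sub>C 1)" if c: "c \<notin> \<real>\<^sub>\<ge>\<^sub>0" for c
  proof (cases "Im c = 0")
    case True
    then have "c = complex_of_real (Re c)" by (simp add: complex_eq_iff)
    then have "a - c *\<^sub>C 1 = a + (- Re c) *\<^sub>R 1" by (metis scaleC_of_real scaleR_minus_left diff_conv_add_uminus)
    moreover have "- Re c > 0" using c True by (auto simp: complex_nonneg_Reals_iff)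
    ultimately show ?thesis using pos_cone_shift_invertible[OF P] by metis
  next
    case False
    define b where "b = a - Re c *\<^sub>R 1"
    have sb: "star b = b" by (simp add: b_def star_diff pos_cone_star[OF P])
    have c_eq: "c = complex_of_real (Re c) + \<i> * complex_of_real (Im c)"
      using complex_eq by simp
    have 1: "a - c *\<^sub>C 1 = b - Im c *\<^sub>R (\<i> *\<^sub>C 1)"
      by (subst c_eq) (simp add: scaleC_add_left scaleC_of_real b_def scaleC_scaleC[symmetric] scaleC_scaleR)
    \<comment> \<open>With \<open>j\<close> the imaginary part of the scalar, \<open>b - j\<close>
      is a commuting factor of \<open>b * b\<close> plus a positive scalar, which is
      invertible.\<close>
    define j :: 'a where "j = Im c *\<^sub>R (\<i> *\<^sub>C 1)"
    have bj: "b * j = j * b" by (simp add: j_def scaleC_one_mult)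
    have jj: "j * j = - ((Im c)\<^sup>2 *\<^sub>R 1)"
      by (simp add: j_def scaleC_mult_left scaleC_scaleC scaleC_minus_left power2_eq_square)
    have eq: "(b - j) * (b + j) = b * b + (Im c)\<^sup>2 *\<^sub>R 1" by (simp add: algebra_simps bj jj)
    have "alg_invertible ((b - j) * (b + j))" unfolding eq
      using False by (intro pos_cone_shift_invertible pos_cone_square sb) simp
    then show ?thesis unfolding 1 j_def[symmetric]
      by (rule alg_invertible_factor) (simp add: algebra_simps bj)
  qed
  then show "positive a" using P by (auto simp: positive_def alg_spectrum_def pos_cone_star)
qed


section \<open>Elements of the form \<open>b * star b\<close>\<close>

text \<open>Away from 0 the spectra of \<open>x * y\<close> and \<open>y * x\<close> agree: the
  inverse for \<open>y * x\<close> is (1 - y r x) / s, where r is the inverse for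
  \<open>x * y\<close>.\<close>

lemma alg_invertible_swap:
  fixes x y :: "'a::unital_cstar_algebra"
  assumes "alg_invertible (x * y + s *\<^sub>R 1)" "s \<noteq> 0"
  shows "alg_invertible (y * x + s *\<^sub>R 1)"
proof -
  obtain r where r: "(x * y + s *\<^sub>R 1) * r = 1" "r * (x * y + s *\<^sub>R 1) = 1"
    using assms by (auto simp: alg_invertible_def)
  define q where "q = (1/s) *\<^sub>R (1 - y * r * x)"
  have "(y * x + s *\<^sub>R 1) * (1 - y * r * x) = y * x + s *\<^sub>R 1 - y * ((x * y + s *\<^sub>R 1) * r) * x"
    by (simp add: algebra_simps)
  then have 1: "(y * x + s *\<^sub>R 1) * q = 1" using assms(2) by (simp add: q_def r)
  have "(1 - y * r * x) * (y * x + s *\<^sub>R 1) = y * x + s *\<^sub>R 1 - y * (r * (x * y + s *\<^sub>R 1)) * x"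
    by (simp add: algebra_simps)
  then have 2: "q * (y * x + s *\<^sub>R 1) = 1" using assms(2) by (simp add: q_def r)
  show ?thesis using 1 2 by (rule alg_invertibleI)
qed

text \<open>Positivity of a self-adjoint element is decided by shifts with \<open>s > 0\<close>, and
  their invertibility is unaffected by the swap.\<close>

lemma pos_cone_swap:
  fixes t :: "'a::unital_cstar_algebra"
  assumes "star t * t \<in> pos_cone" shows "t * star t \<in> pos_cone"
  by (rule pos_cone_of_shifts_invertible)
     (auto simp: star_mult star_star intro!: alg_invertible_swap pos_cone_shift_invertible[OF assms])

text \<open>Kaplansky's argument: with \<open>m = \<bar>z\<bar> - z\<close> for \<open>z = b * star b\<close>, the element \<open>t = m * b\<close>
  satisfies \<open>t * star t = - m\<^sup>3 / 2\<close>, and both \<open>\<plusminus> t * star t\<close> lie in the cone.\<close>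

lemma pos_cone_mult_star: "b * star b \<in> pos_cone" for b :: "'a::unital_cstar_algebra"
proof -
  define z where "z = b * star b"
  have sz: "star z = z" by (simp add: z_def star_mult star_star)
  obtain q where q: "q \<in> pos_cone" "q * q = z * z" "\<And>c. z * z * c = c * (z * z) \<Longrightarrow> q * c = c * q"
    using pos_cone_sqrt[OF pos_cone_square[OF sz]] by blast
  have qz: "q * z = z * q" using q(3)[of z] by (simp add: mult.assoc)
  define m where "m = q - z"
  have sm: "star m = m" by (simp add: m_def star_diff sz pos_cone_star[OF q(1)])
  have qm: "q * m = m * q" by (simp add: m_def algebra_simps qz)
  \<comment> \<open>Since q^2 = z^2, (q - z) z = q z - q^2 = -(q - z) q: on the range of
    \<open>m\<close> the element \<open>z\<close> acts as -|z|.\<close>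
  have mz: "m * z = - (m * q)" by (simp add: m_def algebra_simps qz q(2))
  have mm: "m * m = 2 *\<^sub>R (m * q)"
  proof -
    have "m * m = m * q - m * z" by (simp add: m_def algebra_simps)
    then show ?thesis by (simp add: mz scaleR_2)
  qed
  have mmm: "m * m * m \<in> pos_cone"
  proof -
    have "m * m * q \<in> pos_cone"
      by (intro pos_cone_mult_commute pos_cone_square sm q(1) square_mult_commute qm[symmetric])
    moreover have "m * m * m = 2 *\<^sub>R (m * m * q)"
      by (metis mm mult.assoc mult_scaleR_right)
    ultimately show ?thesis by (simp add: pos_cone_scaleR)
  qed
  define t where "t = m * b"
  have tt: "t * star t = - ((1/2) *\<^sub>R (m * m * m))"
  proof -
    have "t * star t = m * z * m" by (simp add: t_def z_def star_mult sm mult.assoc)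
    also have "\<dots> = - (m * q * m)" by (simp add: mz)
    also have "m * q = (1/2) *\<^sub>R (m * m)" by (simp add: mm)
    finally show ?thesis by simp
  qed
  \<comment> \<open>Up to factors these are the real and imaginary parts of \<open>t\<close>; their
    squares recover \<open>star t * t + t * star t\<close>, from which the known
    \<open>t * star t\<close> is subtracted.\<close>
  define h where "h = t + star t"
  define k where "k = \<i> *\<^sub>C (t - star t)"
  have "star h = h" "star k = k"
    by (simp_all add: h_def k_def star_add star_star star_scaleC star_diff scaleC_minus_left
        scaleC_diff_right)
  then have "(1/2) *\<^sub>R (h * h + k * k) \<in> pos_cone"
    by (intro pos_cone_scaleR pos_cone_add pos_cone_square) auto
  moreover have "star t * t = (1/2) *\<^sub>R (h * h + k * k) + (1/2) *\<^sub>R (m * m * m)"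
  proof -
    have "k * k = - ((t - star t) * (t - star t))"
      by (simp add: k_def scaleC_mult_left scaleC_mult_right scaleC_scaleC scaleC_minus_left)
    then have "h * h + k * k = 2 *\<^sub>R (star t * t + t * star t)"
      by (simp add: h_def algebra_simps scaleR_2)
    then show ?thesis by (simp add: tt)
  qed
  moreover have "(1/2) *\<^sub>R (m * m * m) \<in> pos_cone" using mmm by (simp add: pos_cone_scaleR)
  ultimately have "star t * t \<in> pos_cone" by (simp add: pos_cone_add)
  then have "t * star t \<in> pos_cone" by (rule pos_cone_swap)
  then have "t * star t = 0"
    using pos_cone_antisym[of "t * star t"] \<open>(1/2) *\<^sub>R (m * m * m) \<in> pos_cone\<close> by (simp add: tt)
  then have "m * m * m = 0" by (simp add: tt)
  \<comment> \<open>The fourth power is the square of the self-adjoint \<open>m * m\<close>, so the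
    C*-identity applies twice.\<close>
  then have "(m * m) * (m * m) = 0" by (metis mult.assoc mult_zero_left)
  then have "m * m = 0" using mult_self_eq_zero[of "m * m"] by (simp add: star_mult sm)
  then have "m = 0" using mult_self_eq_zero[OF sm] by simp
  then show ?thesis using q(1) by (simp add: m_def z_def)
qed

lemma pos_cone_conj:
  fixes c :: "'a::unital_cstar_algebra"
  assumes "a \<in> pos_cone" shows "c * a * star c \<in> pos_cone"
proof -
  obtain y where y: "y \<in> pos_cone" "y * y = a" using pos_cone_sqrt[OF assms] by blast
  have "c * a * star c = (c * y) * star (c * y)"
    by (simp add: star_mult pos_cone_star[OF y(1)] y(2)[symmetric] mult.assoc)
  then show ?thesis by (simp only: pos_cone_mult_star)
qed


section \<open>Uniqueness of square roots\<close>

text \<open>With d = a - b, the positive elements d^2 a and d^2 b sum to d (a^2 - b^2) = 0, so both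
  vanish and d^3 = 0.\<close>

lemma pos_cone_sqrt_unique:
  fixes a b :: "'a::unital_cstar_algebra"
  assumes a: "a \<in> pos_cone" and b: "b \<in> pos_cone" and eq: "a * a = b * b" and ab: "a * b = b * a"
  shows "a = b"
proof -
  define d where "d = a - b"
  have sd: "star d = d" by (simp add: d_def star_diff a b pos_cone_star)
  have da: "d * a = a * d" and db: "d * b = b * d" by (simp_all add: d_def algebra_simps ab)
  have "d * d * a \<in> pos_cone" "d * d * b \<in> pos_cone"
    by (intro pos_cone_mult_commute pos_cone_square sd a b square_mult_commute da db)+
  moreover have sum: "d * d * a + d * d * b = 0"
  proof -
    have "d * (a + b) = 0" by (simp add: d_def algebra_simps eq ab)
    then show ?thesis by (metis distrib_left mult.assoc mult_zero_right)
  qed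
  ultimately have "d * d * a = 0" "d * d * b = 0"
    using pos_cone_sum_zero by (metis add.commute)+
  then have "d * d * d = 0" by (simp add: d_def algebra_simps)
  then have "(d * d) * (d * d) = 0" by (metis mult.assoc mult_zero_left)
  then have "d * d = 0" using mult_self_eq_zero[of "d * d"] by (simp add: star_mult sd)
  then have "d = 0" using mult_self_eq_zero[OF sd] by simp
  then show ?thesis by (simp add: d_def)
qed

lemma cstar_sqrt:
  fixes a :: "'a::unital_cstar_algebra"
  assumes "a \<in> pos_cone"
  shows "cstar_sqrt a \<in> pos_cone \<and> (cstar_sqrt a)\<^sup>2 = a"
proof -
  obtain y where y: "y \<in> pos_cone" "y * y = a" "\<And>b. a * b = b * a \<Longrightarrow> y * b = b * y"
    using pos_cone_sqrt[OF assms] by blast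
  have "\<exists>!b. positive b \<and> b\<^sup>2 = a"
  proof (rule ex1I[of _ y])
    show "positive y \<and> y\<^sup>2 = a" using y(1,2) by (simp add: positive_iff power2_eq_square)
    fix b assume b: "positive b \<and> b\<^sup>2 = a"
    \<comment> \<open>Any competing root \<open>b\<close> commutes with its square \<open>a\<close>,
      hence with \<open>y\<close>; this supplies the commutation hypothesis of the uniqueness
      lemma.\<close>
    then have "y * b = b * y" using y(3)[of b] by (auto simp: power2_eq_square mult.assoc)
    then show "b = y"
      using pos_cone_sqrt_unique[of y b] b y(1,2) by (simp add: positive_iff power2_eq_square)
  qed
  from theI'[OF this] show ?thesis by (simp add: cstar_sqrt_def positive_iff)
qed


section \<open>Sublinear functionals\<close>

definition sublinear :: "('v::real_vector \<Rightarrow> real) \<Rightarrow> bool" where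
  "sublinear p \<longleftrightarrow> (\<forall>x y. p (x + y) \<le> p x + p y) \<and> (\<forall>r x. 0 \<le> r \<longrightarrow> p (r *\<^sub>R x) = r * p x)"

lemma sublinearI:
  assumes add: "\<And>x y. p (x + y) \<le> p x + p y" and zero: "p 0 = 0"
    and scale: "\<And>r x. 0 < r \<Longrightarrow> p (r *\<^sub>R x) \<le> r * p x"
  shows "sublinear p"
proof -
  have "p (r *\<^sub>R x) = r * p x" if "0 \<le> r" for r x
  proof (cases "r = 0")
    case False
    then have r: "r > 0" using that by simp
    have "p x \<le> inverse r * p (r *\<^sub>R x)" using scale[of "inverse r" "r *\<^sub>R x"] r by simp
    then have "r * p x \<le> p (r *\<^sub>R x)" using r by (simp add: field_simps)
    then show ?thesis using scale[OF r, of x] by simp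
  qed (simp add: zero)
  then show ?thesis using add by (auto simp: sublinear_def)
qed

lemma sublinear_add: "sublinear p \<Longrightarrow> p (x + y) \<le> p x + p y"
  by (simp add: sublinear_def)

lemma sublinear_scale: "sublinear p \<Longrightarrow> 0 \<le> r \<Longrightarrow> p (r *\<^sub>R x) = r * p x"
  by (simp add: sublinear_def)

lemma sublinear_zero: "sublinear p \<Longrightarrow> p 0 = 0"
  using sublinear_scale[of p 0 0] by simp

lemma sublinear_ge_minus: "sublinear p \<Longrightarrow> - p (- x) \<le> p x"
  using sublinear_add[of p x "- x"] by (simp add: sublinear_zero)

text \<open>The infimum over t \<ge> 0 of q (y + t h) - t q h: t = 0 gives \<open>g \<le> q\<close>,
  and t = 1 at y = -h gives the last claim. It serves both to prove that a minimal functional is odd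
  and to prescribe a value at \<open>h\<close>.\<close>

lemma sublinear_improve:
  assumes q: "sublinear q"
  obtains g where "sublinear g" "g \<le> q" "g (- h) \<le> - q h"
proof -
  define F where "F y t = q (y + t *\<^sub>R h) - t * q h" for y t
  define g where "g y = (INF t\<in>{0..}. F y t)" for y
  have "- q (- y) \<le> F y t" if "0 \<le> t" for y t
    using sublinear_add[OF q, of "y + t *\<^sub>R h" "- y"] sublinear_scale[OF q that, of h]
    by (simp add: F_def)
  then have bd: "bdd_below (F y ` {0..})" for y by (intro bdd_belowI2) auto
  have low: "g y \<le> F y t" if "0 \<le> t" for y t
    unfolding g_def using bd that by (intro cINF_lower) auto
  have grt: "m \<le> g y" if "\<And>t. 0 \<le> t \<Longrightarrow> m \<le> F y t" for m y
    unfolding g_def using that by (intro cINF_greatest) auto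
  have "sublinear g"
  proof (rule sublinearI)
    fix x y
    have "g (x + y) \<le> F x s + F y t" if "0 \<le> s" "0 \<le> t" for s t
    proof -
      have "g (x + y) \<le> F (x + y) (s + t)" using low that by simp
      also have "\<dots> \<le> F x s + F y t"
        using sublinear_add[OF q, of "x + s *\<^sub>R h" "y + t *\<^sub>R h"] by (simp add: F_def algebra_simps)
      finally show ?thesis .
    qed
    then have "g (x + y) - F y t \<le> g x" if "0 \<le> t" for t using that by (intro grt) force
    then have "g (x + y) - g x \<le> g y" by (intro grt) force
    then show "g (x + y) \<le> g x + g y" by simp
  next
    have "F 0 t = 0" if "0 \<le> t" for t using sublinear_scale[OF q that] by (simp add: F_def)
    then show "g 0 = 0" using low[of 0 0] grt[of 0 0] by force
  next
    fix r :: real and x assume r: "0 < r"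
    have "g (r *\<^sub>R x) / r \<le> F x t" if t: "0 \<le> t" for t
    proof -
      have "g (r *\<^sub>R x) \<le> F (r *\<^sub>R x) (r * t)" using low t r by simp
      also have "\<dots> = r * F x t"
        using sublinear_scale[OF q, of r "x + t *\<^sub>R h"] r by (simp add: F_def algebra_simps)
      finally show ?thesis using r by (simp add: field_simps)
    qed
    then have "g (r *\<^sub>R x) / r \<le> g x" by (rule grt)
    then show "g (r *\<^sub>R x) \<le> r * g x" using r by (simp add: field_simps)
  qed
  moreover have "g \<le> q" using low[of 0] by (simp add: le_fun_def F_def)
  moreover have "g (- h) \<le> - q h" using low[of 1 "-h"] sublinear_zero[OF q] by (simp add: F_def)
  ultimately show thesis using that by blast
qed

text \<open>The pointwise infimum works; it is finite because every member lies above -p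
  (-x).\<close>

lemma sublinear_chain_bound:
  assumes C: "C \<noteq> {}" and sub: "\<And>q. q \<in> C \<Longrightarrow> sublinear q \<and> q \<le> p"
    and chain: "\<And>q r. q \<in> C \<Longrightarrow> r \<in> C \<Longrightarrow> q \<le> r \<or> r \<le> q"
  obtains u where "sublinear u" "\<And>q. q \<in> C \<Longrightarrow> u \<le> q"
proof -
  define u where "u x = (INF q\<in>C. q x)" for x
  have "- p (- x) \<le> q x" if "q \<in> C" for q x
  proof -
    have "q (- x) \<le> p (- x)" using sub[OF that] by (simp add: le_fun_def)
    then show ?thesis using sublinear_ge_minus[of q x] sub[OF that] by simp
  qed
  then have bd: "bdd_below ((\<lambda>q. q x) ` C)" for x by (intro bdd_belowI2) auto
  have low: "u x \<le> q x" if "q \<in> C" for q x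
    unfolding u_def using bd that by (intro cINF_lower) auto
  have grt: "m \<le> u x" if "\<And>q. q \<in> C \<Longrightarrow> m \<le> q x" for m x
    unfolding u_def using that C by (intro cINF_greatest) auto
  have "sublinear u"
  proof (rule sublinearI)
    fix x y
    have "u (x + y) \<le> q x + r y" if qr: "q \<in> C" "r \<in> C" for q r
    proof -
      \<comment> \<open>The smaller of the two members of the chain bounds both values at
        once.\<close>
      obtain s where s: "s \<in> C" "s \<le> q" "s \<le> r" using chain[OF qr] qr by blast
      have "u (x + y) \<le> s (x + y)" using low s by simp
      also have "\<dots> \<le> s x + s y" using sub s sublinear_add by blast
      also have "\<dots> \<le> q x + r y" using s by (simp add: le_fun_def add_mono)
      finally show ?thesis .
    qed
    then have "u (x + y) - r y \<le> u x" if "r \<in> C" for r using that by (intro grt) force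
    then have "u (x + y) - u x \<le> u y" by (intro grt) force
    then show "u (x + y) \<le> u x + u y" by simp
  next
    have "q 0 = 0" if "q \<in> C" for q using sub that sublinear_zero by blast
    then have "u 0 = (INF q\<in>C. 0)" unfolding u_def by (intro INF_cong) auto
    then show "u 0 = 0" using C by simp
  next
    fix r :: real and x assume r: "0 < r"
    have "u (r *\<^sub>R x) / r \<le> q x" if "q \<in> C" for q
      using low[OF that, of "r *\<^sub>R x"] sub[OF that] r sublinear_scale[of q r x]
      by (simp add: field_simps)
    then have "u (r *\<^sub>R x) / r \<le> u x" by (rule grt)
    then show "u (r *\<^sub>R x) \<le> r * u x" using r by (simp add: field_simps)
  qed
  with that low show thesis by (auto simp: le_fun_def)
qed

lemma minimal_sublinear:
  assumes "sublinear p"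
  obtains m where "sublinear m" "m \<le> p" "\<And>q. sublinear q \<Longrightarrow> q \<le> m \<Longrightarrow> q = m"
proof -
  define A where "A = {q. sublinear q \<and> q \<le> p}"
  \<comment> \<open>The order is reversed, so that the maximal element from Zorn's lemma is a
    minimal functional.\<close>
  define P where "P = (\<lambda>q r :: 'a \<Rightarrow> real. r \<le> q)"
  have "\<exists>m\<in>A. \<forall>a\<in>A. P m a \<longrightarrow> a = m"
  proof (rule predicate_Zorn)
    show "partial_order_on A (relation_of P A)"
      by (auto simp: partial_order_on_def preorder_on_def refl_on_def relation_of_def P_def
          intro!: transI antisymI)
    fix C assume "C \<in> Chains (relation_of P A)"
    then have C: "C \<subseteq> A" "\<And>q r. q \<in> C \<Longrightarrow> r \<in> C \<Longrightarrow> q \<le> r \<or> r \<le> q"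
      by (auto simp: Chains_def relation_of_def P_def)
    show "\<exists>u\<in>A. \<forall>a\<in>C. P a u"
    proof (cases "C = {}")
      case True
      then show ?thesis using assms by (auto simp: A_def)
    next
      case False
      obtain u where u: "sublinear u" "\<And>q. q \<in> C \<Longrightarrow> u \<le> q"
        using sublinear_chain_bound[OF False, of p] C by (auto simp: A_def)
      then have "u \<in> A" using False C(1) by (force simp: A_def)
      then show ?thesis using u by (auto simp: P_def)
    qed
  qed
  then obtain m where m: "m \<in> A" "\<And>q. q \<in> A \<Longrightarrow> q \<le> m \<Longrightarrow> q = m" by (auto simp: P_def)
  show thesis
  proof (rule that)
    fix q assume "sublinear q" "q \<le> m"
    then show "q = m" using m by (auto simp: A_def)
  qed (use m(1) in \<open>auto simp: A_def\<close>)
qed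

text \<open>A minimal sublinear functional is odd, hence linear. Minimality is taken below the
  improved \<open>g\<close>, so that \<open>f (- h) \<le> - p h\<close> forces equality at
  \<open>h\<close>.\<close>

theorem Hahn_Banach_sublinear:
  fixes p :: "'v::real_vector \<Rightarrow> real"
  assumes "sublinear p"
  obtains f where "linear f" "\<And>x. f x \<le> p x" "f h = p h"
proof -
  obtain g where g: "sublinear g" "g \<le> p" "g (- h) \<le> - p h"
    using sublinear_improve[OF assms] by blast
  obtain f where f: "sublinear f" "f \<le> g" "\<And>q. sublinear q \<Longrightarrow> q \<le> f \<Longrightarrow> q = f"
    using minimal_sublinear[OF g(1)] by blast
  have neg: "f (- x) = - f x" for x
  proof -
    obtain q where "sublinear q" "q \<le> f" "q (- x) \<le> - f x"
      using sublinear_improve[OF f(1)] by blast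
    then have "f (- x) \<le> - f x" using f(3) by blast
    then show ?thesis using sublinear_ge_minus[OF f(1), of x] by simp
  qed
  have lin: "linear f"
  proof (rule linearI)
    fix x y
    show "f (x + y) = f x + f y"
      using sublinear_add[OF f(1), of x y] sublinear_add[OF f(1), of "-x" "-y"] neg[of "x + y"]
      by (simp add: neg)
  next
    fix r x
    show "f (r *\<^sub>R x) = r *\<^sub>R f x"
      using sublinear_scale[OF f(1), of r x] sublinear_scale[OF f(1), of "- r" x] neg[of "r *\<^sub>R x"]
      by (cases "0 \<le> r") auto
  qed
  have le: "f x \<le> p x" for x using f(2) g(2) by (meson le_fun_def order_trans)
  have "f (- h) \<le> - p h" using f(2) g(3) by (meson le_fun_def order_trans)
  then have "f h = p h" using neg[of h] le[of h] by simp
  with lin le show thesis using that by blast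
qed


section \<open>Strictly positive elements\<close>

text \<open>The real part extends the largest spectral value to a sublinear functional on the whole
  algebra as a real vector space.\<close>

definition herm_part :: "'a::unital_cstar_algebra \<Rightarrow> 'a" where
  "herm_part x = (1/2) *\<^sub>R (x + star x)"

lemma star_herm_part: "star (herm_part x) = herm_part x"
  by (simp add: herm_part_def star_add star_star add.commute)

lemma herm_part_eq: "star x = x \<Longrightarrow> herm_part x = x"
  by (simp add: herm_part_def flip: scaleR_2)

lemma herm_part_add: "herm_part (x + y) = herm_part x + herm_part y"
  by (simp add: herm_part_def star_add algebra_simps)

lemma herm_part_scaleR: "herm_part (r *\<^sub>R x) = r *\<^sub>R herm_part x"
  by (simp add: herm_part_def algebra_simps)

lemma herm_part_imaginary: "star x = x \<Longrightarrow> herm_part (\<i> *\<^sub>C x) = 0"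
  by (simp add: herm_part_def star_scaleC scaleC_minus_left)

text \<open>The largest spectral value of the hermitian part.\<close>

definition spec_bound :: "'a::unital_cstar_algebra \<Rightarrow> real" where
  "spec_bound x = Inf {t. t *\<^sub>R 1 - herm_part x \<in> pos_cone}"

context
  assumes nontrivial: "(1::'a::unital_cstar_algebra) \<noteq> 0"
begin

text \<open>Nontriviality enters here: in the zero algebra every real \<open>t\<close> would qualify
  in \<open>spec_bound\<close>, and the infimum would be meaningless.\<close>

lemma scalar_pos_cone_imp_nonneg:
  assumes "s *\<^sub>R (1::'a) \<in> pos_cone" shows "0 \<le> s"
proof (rule ccontr)
  assume "\<not> 0 \<le> s"
  then have "- (s *\<^sub>R (1::'a)) \<in> pos_cone" using pos_cone_scalar[of "- s"] by simp
  then have "s *\<^sub>R (1::'a) = 0" using assms pos_cone_antisym by blast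
  then show False using nontrivial \<open>\<not> 0 \<le> s\<close> by simp
qed

lemma bdd_below_spec_bound: "bdd_below {t. t *\<^sub>R 1 - herm_part (x::'a) \<in> pos_cone}"
proof (rule bdd_belowI)
  fix t assume t: "t \<in> {t. t *\<^sub>R 1 - herm_part x \<in> pos_cone}"
  have "norm (herm_part x) *\<^sub>R 1 + herm_part x \<in> pos_cone"
    by (intro norm_plus_pos_cone star_herm_part order_refl)
  with t have "(t *\<^sub>R 1 - herm_part x) + (norm (herm_part x) *\<^sub>R 1 + herm_part x) \<in> pos_cone"
    by (simp only: mem_Collect_eq pos_cone_add)
  then have "(t + norm (herm_part x)) *\<^sub>R (1::'a) \<in> pos_cone" by (simp add: algebra_simps)
  then show "- norm (herm_part x) \<le> t" using scalar_pos_cone_imp_nonneg by force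
qed

lemma spec_bound_le: "t *\<^sub>R 1 - herm_part (x::'a) \<in> pos_cone \<Longrightarrow> spec_bound x \<le> t"
  unfolding spec_bound_def by (rule cInf_lower) (auto simp: bdd_below_spec_bound)

lemma spec_bound_attained: "spec_bound x *\<^sub>R 1 - herm_part (x::'a) \<in> pos_cone"
proof -
  have "closed ((\<lambda>t. t *\<^sub>R 1 - herm_part x) -` pos_cone)"
    by (intro continuous_closed_vimage[OF closed_pos_cone]) (auto intro!: continuous_intros)
  then have "closed {t. t *\<^sub>R 1 - herm_part x \<in> pos_cone}" by (simp add: vimage_def)
  moreover have "norm (herm_part x) \<in> {t. t *\<^sub>R 1 - herm_part x \<in> pos_cone}"
    by (simp add: norm_minus_pos_cone star_herm_part)
  ultimately have "spec_bound x \<in> {t. t *\<^sub>R 1 - herm_part x \<in> pos_cone}"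
    unfolding spec_bound_def using bdd_below_spec_bound by (intro closed_contains_Inf) auto
  then show ?thesis by simp
qed

lemma sublinear_spec_bound: "sublinear (spec_bound :: 'a \<Rightarrow> real)"
proof (rule sublinearI)
  fix x y :: 'a
  have "(spec_bound x *\<^sub>R 1 - herm_part x) + (spec_bound y *\<^sub>R 1 - herm_part y) \<in> pos_cone"
    by (intro pos_cone_add spec_bound_attained)
  then show "spec_bound (x + y) \<le> spec_bound x + spec_bound y"
    by (intro spec_bound_le) (simp add: herm_part_add algebra_simps)
next
  have "herm_part (0::'a) = 0" by (simp add: herm_part_def)
  then have "spec_bound (0::'a) \<le> 0" "0 \<le> spec_bound (0::'a)"
    using spec_bound_le[of 0 0] spec_bound_attained[of 0] scalar_pos_cone_imp_nonneg
    by (simp_all add: pos_cone_zero)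
  then show "spec_bound (0::'a) = 0" by simp
next
  fix r :: real and x :: 'a assume "0 < r"
  then have "r *\<^sub>R (spec_bound x *\<^sub>R 1 - herm_part x) \<in> pos_cone"
    by (intro pos_cone_scaleR spec_bound_attained) simp
  then show "spec_bound (r *\<^sub>R x) \<le> r * spec_bound x"
    by (intro spec_bound_le) (simp add: herm_part_scaleR algebra_simps)
qed

text \<open>Hahn-Banach gives a real functional dominated by \<open>spec_bound\<close> and equal to
  it at \<open>h\<close>; \<phi> is its complexification. Domination at \<open>- a\<close> yields
  positivity, and at \<open>- 1\<close> it yields \<phi> \<noteq> 0.\<close>

lemma positive_form_attaining:
  fixes h :: 'a
  assumes "star h = h"
  obtains \<phi> where "positive_form \<phi>" "\<phi> \<noteq> (\<lambda>_. 0)" "\<phi> h = complex_of_real (spec_bound h)"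
proof -
  obtain f where f: "linear f" "\<And>x. f x \<le> spec_bound x" "f h = spec_bound h"
    using Hahn_Banach_sublinear[OF sublinear_spec_bound] by blast
  have f_add: "f (x + y) = f x + f y" and f_scale: "f (r *\<^sub>R x) = r * f x"
    and f_minus: "f (- x) = - f x" for r x y
    using f(1) by (simp_all add: linear_add linear_scale linear_neg)
  define \<phi> where "\<phi> x = complex_of_real (f x) - \<i> * complex_of_real (f (\<i> *\<^sub>C x))" for x
  \<comment> \<open>For self-adjoint \<open>x\<close> both \<i>x and -\<i>x have zero real part, so
    domination bounds \<open>f\<close> there from both sides by 0.\<close>
  have im: "f (\<i> *\<^sub>C x) = 0" if "star x = x" for x
  proof -
    have "spec_bound (\<i> *\<^sub>C y) \<le> 0" if "star y = y" for y :: 'a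
      using spec_bound_le[of 0 "\<i> *\<^sub>C y"] herm_part_imaginary[OF that] by (simp add: pos_cone_zero)
    from this[of x] this[of "- x"] f(2)[of "\<i> *\<^sub>C x"] f(2)[of "- (\<i> *\<^sub>C x)"] that
    show ?thesis by (simp add: scaleC_minus_right f_minus)
  qed
  have real: "\<phi> x = complex_of_real (f x)" if "star x = x" for x
    by (simp add: \<phi>_def im that)
  have "positive_form \<phi>" unfolding positive_form_def
  proof (intro conjI allI impI)
    fix a b show "\<phi> (a + b) = \<phi> a + \<phi> b"
      by (simp add: \<phi>_def f_add scaleC_add_right algebra_simps)
  next
    fix c a
    have c: "c *\<^sub>C y = Re c *\<^sub>R y + Im c *\<^sub>R (\<i> *\<^sub>C y)" for y :: 'a
    proof -
      have "c = complex_of_real (Re c) + complex_of_real (Im c) * \<i>"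
        by (simp add: complex_eq_iff)
      then have "c *\<^sub>C y = (complex_of_real (Re c) + complex_of_real (Im c) * \<i>) *\<^sub>C y" by simp
      then show ?thesis by (simp only: scaleC_add_left scaleC_scaleC[symmetric] scaleC_of_real)
    qed
    have "f (c *\<^sub>C a) = Re c * f a + Im c * f (\<i> *\<^sub>C a)" by (simp add: c[of a] f_add f_scale)
    moreover have "\<i> *\<^sub>C c *\<^sub>C a = Re c *\<^sub>R (\<i> *\<^sub>C a) - Im c *\<^sub>R a"
      by (simp add: c[of a] scaleC_add_right scaleC_scaleR scaleC_scaleC scaleC_minus_left)
    then have "f (\<i> *\<^sub>C c *\<^sub>C a) = Re c * f (\<i> *\<^sub>C a) - Im c * f a"
      using f_add[of "Re c *\<^sub>R (\<i> *\<^sub>C a)" "- (Im c *\<^sub>R a)"] by (simp add: f_scale f_minus)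
    ultimately show "\<phi> (c *\<^sub>C a) = c * \<phi> a"
      by (simp add: \<phi>_def complex_eq_iff algebra_simps)
  next
    fix a :: 'a assume "positive a"
    then have a: "a \<in> pos_cone" by (simp add: positive_iff)
    then have sa: "star a = a" by (rule pos_cone_star)
    have "spec_bound (- a) \<le> 0" using spec_bound_le[of 0 "- a"] sa a by (simp add: herm_part_eq)
    then have "0 \<le> f a" using f(2)[of "- a"] by (simp add: f_minus)
    then show "\<phi> a \<in> \<real>\<^sub>\<ge>\<^sub>0" by (simp add: real[OF sa])
  qed
  moreover have "\<phi> \<noteq> (\<lambda>_. 0)"
  proof
    assume "\<phi> = (\<lambda>_. 0)"
    then have "f 1 = 0" using real[of 1] by (metis of_real_eq_0_iff star_one)
    moreover have "spec_bound (- 1 :: 'a) \<le> - 1"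
      using spec_bound_le[of "- 1" "- 1"] by (simp add: herm_part_eq pos_cone_zero)
    ultimately show False using f(2)[of "- 1"] by (simp add: f_minus)
  qed
  ultimately show thesis using that real[OF assms] f(3) by simp
qed

end

text \<open>A self-adjoint \<open>k\<close> is the difference of the positive elements
  \<open>norm k *\<^sub>R 1 + k\<close> and \<open>norm k *\<^sub>R 1\<close>.\<close>

lemma positive_form_real:
  fixes k :: "'a::unital_cstar_algebra"
  assumes "positive_form \<phi>" "star k = k" shows "\<phi> k \<in> \<real>"
proof -
  have add: "\<phi> (a + b) = \<phi> a + \<phi> b" and pos: "positive a \<Longrightarrow> \<phi> a \<in> \<real>\<^sub>\<ge>\<^sub>0" for a b
    using assms by (auto simp: positive_form_def)
  have "\<phi> (norm k *\<^sub>R 1 + k) \<in> \<real>" "\<phi> (norm k *\<^sub>R 1) \<in> \<real>"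
    using pos norm_plus_pos_cone[OF assms(2)] pos_cone_scalar[of "norm k"]
    by (auto simp: positive_iff intro: nonneg_Reals_subset_Reals[THEN subsetD])
  then show ?thesis unfolding add by (metis Reals_diff add_diff_cancel_left')
qed

text \<open>Real values on \<open>a\<close> force every nonzero positive form to vanish on the
  imaginary part \<open>k\<close>. Forms attaining the spectral bounds of \<open>k\<close> and
  \<open>- k\<close> then put both in the cone.\<close>

lemma strictly_positive_star:
  fixes a :: "'a::unital_cstar_algebra"
  assumes a: "strictly_positive a" shows "star a = a"
proof (cases "(1::'a) = 0")
  case True
  then show ?thesis by (metis mult_1_right mult_zero_right)
next
  case False
  define h where "h = herm_part a"
  define k where "k = herm_part ((- \<i>) *\<^sub>C a)"
  have sk: "star k = k" by (simp add: k_def star_herm_part)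
  have ik: "\<i> *\<^sub>C k = (1/2) *\<^sub>R (a - star a)"
    by (simp add: k_def herm_part_def star_scaleC scaleC_scaleR scaleC_add_right scaleC_scaleC
        scaleC_minus_left scaleC_minus_right scaleC_diff_right)
  then have dec: "a = h + \<i> *\<^sub>C k"
    by (simp add: h_def herm_part_def flip: scaleR_add_right)
  have zero: "\<phi> k = 0" if \<phi>: "positive_form \<phi>" "\<phi> \<noteq> (\<lambda>_. 0)" for \<phi>
  proof -
    have "\<phi> a = \<phi> h + \<i> * \<phi> k" using \<phi>(1) dec by (metis positive_form_def)
    moreover have "\<phi> a \<in> \<real>" using a \<phi> by (simp add: strictly_positive_def)
    moreover have "\<phi> h \<in> \<real>" "\<phi> k \<in> \<real>"
      using positive_form_real[OF \<phi>(1)] sk by (auto simp: h_def star_herm_part)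
    ultimately show ?thesis by (auto simp: complex_is_Real_iff complex_eq_iff)
  qed
  have "- y \<in> pos_cone" if y: "star y = y" "y = k \<or> y = - k" for y
  proof -
    obtain \<phi> where \<phi>: "positive_form \<phi>" "\<phi> \<noteq> (\<lambda>_. 0)" "\<phi> y = complex_of_real (spec_bound y)"
      using positive_form_attaining[OF False y(1)] by blast
    have "\<phi> (- k) = - \<phi> k"
      using \<phi>(1) scaleC_minus_left[of 1 k] unfolding positive_form_def
      by (metis mult_minus1 scaleC_one)
    then have "\<phi> y = 0" using zero[OF \<phi>(1,2)] y(2) by auto
    then have "spec_bound y = 0" using \<phi>(3) by simp
    then show ?thesis using spec_bound_attained[OF False, of y] by (simp add: herm_part_eq y(1))
  qed
  from this[of k] this[of "- k"] have "k = 0" by (simp add: sk pos_cone_antisym)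
  then show ?thesis using ik by simp
qed

text \<open>A form attaining the bound at \<open>- a\<close> shows that this bound is negative, so
  \<open>a\<close> is a positive element plus a positive scalar.\<close>

lemma strictly_positive_invertible:
  fixes a :: "'a::unital_cstar_algebra"
  assumes a: "strictly_positive a" shows "alg_invertible a"
proof (cases "(1::'a) = 0")
  case True
  then show ?thesis by (metis alg_invertible_def mult_1_right mult_zero_right)
next
  case False
  have sa: "star (- a) = - a" by (simp add: strictly_positive_star[OF a])
  obtain \<phi> where \<phi>: "positive_form \<phi>" "\<phi> \<noteq> (\<lambda>_. 0)" "\<phi> (- a) = complex_of_real (spec_bound (- a))"
    using positive_form_attaining[OF False sa] by blast
  have "\<phi> (- a) = - \<phi> a"
    using \<phi>(1) scaleC_minus_left[of 1 a] unfolding positive_form_def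
    by (metis mult_minus1 scaleC_one)
  moreover have "Re (\<phi> a) > 0" using a \<phi> by (simp add: strictly_positive_def)
  ultimately have neg: "spec_bound (- a) < 0" using \<phi>(3) by (metis Re_complex_of_real neg_less_0_iff_less uminus_complex.sel(1))
  have "spec_bound (- a) *\<^sub>R 1 + a \<in> pos_cone"
    using spec_bound_attained[OF False, of "- a"] by (simp add: herm_part_eq[OF sa])
  from pos_cone_shift_invertible[OF this, of "- spec_bound (- a)"] neg show ?thesis by simp
qed


section \<open>Inner products\<close>

context hilbert_module
begin

lemma smul_scaleC_one: "smul (c *\<^sub>C 1) x = c *\<^sub>C x"
  by (simp add: scaleC_smul_left smul_one)

lemma ip_scaleC_left: "ip (c *\<^sub>C x) y = c *\<^sub>C ip x y"
  by (metis ip_smul_left smul_scaleC_one scaleC_one_mult(1))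

lemma ip_scaleR_left: "ip (r *\<^sub>R x) y = r *\<^sub>R ip x y"
  by (metis ip_scaleC_left scaleC_of_real)

lemma ip_zero_left [simp]: "ip 0 y = 0"
  using ip_scaleR_left[of 0 0 y] by simp

lemma ip_minus_left: "ip (- x) y = - ip x y"
  using ip_scaleR_left[of "- 1" x y] by simp

lemma ip_diff_left: "ip (x - y) z = ip x z - ip y z"
  using ip_add_left[of x "- y" z] by (simp add: ip_minus_left)

lemma ip_diff_right: "ip x (y - z) = ip x y - ip x z"
  by (metis ip_diff_left ip_star star_diff)

lemma ip_smul_right: "ip x (smul a y) = ip x y * star a"
  by (metis ip_smul_left ip_star star_mult)

lemma ip_scaleC_right: "ip x (c *\<^sub>C y) = cnj c *\<^sub>C ip x y"
  by (metis ip_scaleC_left ip_star star_scaleC)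

lemma ip_sum_left: "ip (sum f I) y = (\<Sum>i\<in>I. ip (f i) y)"
  by (induction I rule: infinite_finite_induct) (auto simp: ip_add_left)

lemma smul_zero_left [simp]: "smul 0 x = 0"
  using smul_add_left[of 0 0 x] by simp

lemma smul_minus_one: "smul (- 1) x = - x"
  using smul_add_left[of "-1" 1 x] by (simp add: smul_one add_eq_0_iff2)

lemma smul_scaleR_right: "smul a (r *\<^sub>R x) = r *\<^sub>R smul a x"
  by (metis scaleC_of_real scaleC_smul_right)

lemma smul_diff_right: "smul a (x - y) = smul a x - smul a y"
  by (metis add_diff_cancel diff_add_cancel smul_add_right)

lemma ip_self_pos_cone: "ip x x \<in> pos_cone"
  using ip_positive positive_iff by blast

lemma hmod_square: "(hmod ip x)\<^sup>2 = ip x x"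
  using cstar_sqrt[OF ip_self_pos_cone] by (simp add: hmod_def)

lemma norm_square: "(norm x)\<^sup>2 = norm (ip x x)"
proof -
  have "star (hmod ip x) = hmod ip x"
    using cstar_sqrt[OF ip_self_pos_cone] by (simp add: hmod_def pos_cone_star)
  then have "(norm (hmod ip x))\<^sup>2 = norm ((hmod ip x)\<^sup>2)"
    by (simp add: norm_mult_self power2_eq_square)
  then show ?thesis by (simp add: norm_eq hmod_square)
qed

text \<open>Stated for semidefinite forms, to cover weighted sums as well as \<open>ip\<close>.
  Positivity at x - t F(x,y) y is turned into a real inequality in t by taking norms, and t is then
  chosen.\<close>

lemma Cauchy_Schwarz_form:
  fixes F :: "'h \<Rightarrow> 'h \<Rightarrow> 'a"
  assumes add: "\<And>x y z. F (x + y) z = F x z + F y z" and sm: "\<And>a x y. F (smul a x) y = a * F x y"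
    and st: "\<And>x y. star (F x y) = F y x" and pos: "\<And>x. F x x \<in> pos_cone"
  shows "(norm (F x y))\<^sup>2 \<le> norm (F x x) * norm (F y y)"
proof -
  define b where "b = F x y"
  define e where "e = F y y"
  define \<beta> where "\<beta> = (norm b)\<^sup>2"
  have add_r: "F x (y + z) = F x y + F x z" for x y z by (metis add st star_add)
  have sm_r: "F x (smul a y) = F x y * star a" for a x y by (metis sm st star_mult)
  have nb: "norm (b * star b) = \<beta>"
    using cstar_identity[of "star b"] by (simp add: \<beta>_def star_star)
  have main: "2 * t * \<beta> \<le> norm (F x x) + t\<^sup>2 * (\<beta> * norm e)" if t: "0 \<le> t" for t
  proof -
    define v where "v = x + smul ((- t) *\<^sub>R b) y"
    have "F v v = F x x - (2 * t) *\<^sub>R (b * star b) + t\<^sup>2 *\<^sub>R (b * e * star b)"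
      using st[of x y]
      by (simp add: v_def add add_r sm sm_r b_def e_def algebra_simps power2_eq_square)
         (simp flip: scaleR_add_left)
    then have "(F x x + t\<^sup>2 *\<^sub>R (b * e * star b)) - (2 * t) *\<^sub>R (b * star b) \<in> pos_cone"
      using pos[of v] by (simp only: diff_add_eq)
    then have "norm ((2 * t) *\<^sub>R (b * star b)) \<le> norm (F x x + t\<^sup>2 *\<^sub>R (b * e * star b))"
      by (intro norm_mono_pos_cone pos_cone_scaleR pos_cone_mult_star) (use t in auto)
    also have "\<dots> \<le> norm (F x x) + t\<^sup>2 * norm (b * e * star b)"
      by (rule norm_triangle_le) simp
    also have "\<dots> \<le> norm (F x x) + t\<^sup>2 * (norm b * norm e * norm b)"
      by (intro add_left_mono mult_left_mono)
         (metis norm_mult_ineq norm_star mult_right_mono norm_ge_zero order_trans, simp)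
    finally have "2 * t * norm (b * star b) \<le> \<dots>" using t by simp
    then show ?thesis by (simp add: nb) (simp add: \<beta>_def power2_eq_square mult_ac)
  qed
  have \<beta>0: "\<beta> \<ge> 0" by (simp add: \<beta>_def)
  have "\<beta> \<le> norm (F x x) * norm e"
  proof (cases "norm e = 0")
    case True
    show ?thesis
    proof (rule ccontr)
      assume "\<not> ?thesis"
      then have "\<beta> > 0" using True by simp
      \<comment> \<open>When \<open>e = 0\<close> the quadratic term in t is absent, and this t
        makes the left side exceed the right.\<close>
      have "2 * ((norm (F x x) + 1) / \<beta>) * \<beta> \<le> norm (F x x)"
        using main[of "(norm (F x x) + 1) / \<beta>"] True \<beta>0 by simp
      then show False using \<open>\<beta> > 0\<close> norm_ge_zero[of "F x x"] by simp
    qed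
  next
    case False
    then have e: "norm e > 0" by simp
    then show ?thesis
      using main[of "1 / norm e"] by (simp add: field_simps power2_eq_square)
  qed
  then show ?thesis by (simp add: \<beta>_def b_def e_def)
qed

lemma norm_ip_le: "norm (ip x y) \<le> norm x * norm y"
proof (rule power2_le_imp_le)
  show "(norm (ip x y))\<^sup>2 \<le> (norm x * norm y)\<^sup>2"
    unfolding power_mult_distrib norm_square
    by (rule Cauchy_Schwarz_form)
       (auto simp: ip_add_left ip_smul_left ip_star ip_self_pos_cone)
qed simp

lemma norm_smul_le: "norm (smul a x) \<le> norm a * norm x"
proof (rule power2_le_imp_le)
  have "(norm (smul a x))\<^sup>2 = norm (a * ip x x * star a)"
    by (simp add: norm_square ip_smul_left ip_smul_right mult.assoc)
  also have "\<dots> \<le> norm a * norm (ip x x) * norm a"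
    by (metis norm_mult_ineq norm_star mult_right_mono norm_ge_zero order_trans)
  finally show "(norm (smul a x))\<^sup>2 \<le> (norm a * norm x)\<^sup>2"
    by (simp add: norm_square[symmetric] power2_eq_square mult_ac)
qed simp

lemma bounded_linear_smul: "bounded_linear (smul a)"
  by (rule bounded_linear_intro[where K="norm a"])
     (auto simp: smul_add_right smul_scaleR_right norm_smul_le mult.commute)

lemma bounded_linear_ip_left: "bounded_linear (\<lambda>x. ip x y)"
  by (rule bounded_linear_intro[where K="norm y"])
     (auto simp: ip_add_left ip_scaleR_left norm_ip_le)

lemma norm_ge_of_ip:
  assumes "d * (norm x)\<^sup>2 \<le> norm (ip y x)" shows "d * norm x \<le> norm y"
proof (cases "norm x = 0")
  case False
  have "(d * norm x) * norm x \<le> norm y * norm x"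
    using assms norm_ip_le[of y x] by (simp add: power2_eq_square mult.assoc)
  then show ?thesis using False by simp
qed simp

end


section \<open>Surjectivity by continuation\<close>

text \<open>If \<open>T + r e\<close> is bounded below uniformly in \<open>r \<ge> 0\<close>, surjectivity propagates by fixed steps
  from large \<open>r\<close> down to \<open>r = 0\<close>.\<close>

lemma surj_of_uniformly_bounded_below:
  fixes T :: "'h::{complex_normed_vector, banach} \<Rightarrow> 'h"
  assumes T: "bounded_linear T" and e: "cmod e = 1" and d: "0 < d"
    and below: "\<And>r x. 0 \<le> r \<Longrightarrow> d * norm x \<le> norm (T x + (complex_of_real r * e) *\<^sub>C x)"
  shows "surj T"
proof -
  interpret T: bounded_linear T by (rule T)
  define L where "L r x = T x + (complex_of_real r * e) *\<^sub>C x" for r x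
  have L_diff: "L r (x - y) = L r x - L r y" for r x y
    by (simp add: L_def T.diff scaleC_diff_right)
  have L_shift: "L s x = L r x + (complex_of_real (s - r) * e) *\<^sub>C x" for r s x
    by (simp add: L_def add.assoc scaleC_add_left[symmetric] algebra_simps)
  have step: "surj (L s)" if surj: "surj (L r)" and r: "0 \<le> r" and rs: "\<bar>s - r\<bar> \<le> d / 2" for r s
  proof (unfold surj_def, rule allI)
    fix y
    define R where "R = inv (L r)"
    have LR: "L r (R u) = u" for u by (simp add: R_def surj_f_inv_f[OF surj])
    have R_lip: "d * norm (R u - R v) \<le> norm (u - v)" for u v
      using below[OF r, of "R u - R v"] by (simp add: L_def[symmetric] L_diff LR)
    \<comment> \<open>A fixed point of \<open>G\<close> solves \<open>L s x = y\<close>. The lower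
      bound makes \<open>R\<close> Lipschitz with constant 1/d, and steps of length at most d/2 make
      \<open>G\<close> a contraction.\<close>
    define G where "G x = R (y - (complex_of_real (s - r) * e) *\<^sub>C x)" for x
    have "dist (G x) (G z) \<le> (1/2) * dist x z" for x z
    proof -
      have "d * norm (G x - G z) \<le> norm ((complex_of_real (s - r) * e) *\<^sub>C (z - x))"
        unfolding G_def by (rule order_trans[OF R_lip]) (simp add: scaleC_diff_right)
      also have "\<dots> = \<bar>s - r\<bar> * norm (x - z)"
        by (simp add: norm_scaleC norm_mult e norm_minus_commute del: of_real_diff)
      also have "\<dots> \<le> (d / 2) * norm (x - z)" using rs by (intro mult_right_mono) auto
      finally show ?thesis using d by (simp add: dist_norm)
    qed
    then obtain x where "G x = x" using banach_fix_type[of "1/2" G] by auto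
    then have "L r x = y - (complex_of_real (s - r) * e) *\<^sub>C x" using LR unfolding G_def by metis
    then show "\<exists>x. y = L s x" using L_shift[of s x r] by auto
  qed
  have large: "surj (L r)" if r: "r > 0" "2 * onorm T \<le> r" for r
  proof (unfold surj_def, rule allI)
    fix y
    define c where "c = 1 / (complex_of_real r * e)"
    have e0: "e \<noteq> 0" using e by auto
    have nc: "cmod c = 1 / r" using e r by (simp add: c_def norm_divide norm_mult)
    \<comment> \<open>For large \<open>r\<close> the scalar term dominates, and the equation is
      solved for that term: x = (y - T x) / (r e).\<close>
    define G where "G x = c *\<^sub>C (y - T x)" for x
    have "dist (G x) (G z) \<le> (1/2) * dist x z" for x z
    proof -
      have "norm (G x - G z) = (1 / r) * norm (T (z - x))"
        unfolding G_def
        by (simp add: scaleC_diff_right[symmetric] norm_scaleC nc T.diff)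
      also have "\<dots> \<le> (1 / r) * (onorm T * norm (z - x))"
        using r by (intro mult_left_mono onorm T) auto
      also have "\<dots> \<le> (1/2) * norm (z - x)"
        using r mult_right_mono[OF r(2) norm_ge_zero[of "z - x"]] by (simp add: field_simps)
      finally show ?thesis by (simp add: dist_norm norm_minus_commute)
    qed
    then obtain x where x: "c *\<^sub>C (y - T x) = x"
      using banach_fix_type[of "1/2" G] unfolding G_def by auto
    have "(complex_of_real r * e) *\<^sub>C (c *\<^sub>C (y - T x)) = y - T x"
      using r e0 by (simp add: scaleC_scaleC c_def)
    then show "\<exists>x. y = L r x" unfolding x by (auto simp: L_def intro!: exI[of _ x])
  qed
  \<comment> \<open>The extra \<open>d\<close> makes the starting parameter strictly positive even
    if \<open>onorm T = 0\<close>.\<close>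
  obtain N :: nat where N: "2 * onorm T + d < real N * (d / 2)"
    using reals_Archimedean3[of "d / 2", rule_format, of "2 * onorm T + d"] d by auto
  have "surj (L (real N * (d / 2)))"
    using N d onorm_pos_le[OF T] by (intro large) auto
  moreover have "surj (L (real n * (d / 2)))" if "surj (L (real (Suc n) * (d / 2)))" for n
    by (rule step[OF that]) (use d in \<open>auto simp: algebra_simps\<close>)
  ultimately have "surj (L (real 0 * (d / 2)))" by (induction N) auto
  then show ?thesis by (simp add: L_def)
qed


section \<open>Operators\<close>

context hilbert_module
begin

lemma bounded_operator_inv:
  assumes T: "bounded_operator smul T" and d: "0 < d" "\<And>x. d * norm x \<le> norm (T x)"
    and surj: "surj T"
  shows "bounded_operator smul (inv T)" "inj T"
proof -
  interpret T: bounded_linear T using T by (simp add: bounded_operator_def)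
  show inj: "inj T"
  proof (rule injI)
    fix x y assume "T x = T y"
    then show "x = y" using d(2)[of "x - y"] d(1) by (simp add: T.diff zero_less_mult_iff)
         (metis norm_ge_zero mult_le_0_iff not_le norm_le_zero_iff eq_iff_diff_eq_0)
  qed
  have TR: "T (inv T x) = x" for x by (simp add: surj surj_f_inv_f)
  have eq: "inv T x = y" if "T y = x" for x y using that inj by auto
  have "bounded_linear (inv T)"
  proof (rule bounded_linear_intro[where K="1 / d"])
    fix x y show "inv T (x + y) = inv T x + inv T y" by (rule eq) (simp add: T.add TR)
  next
    fix r x show "inv T (r *\<^sub>R x) = r *\<^sub>R inv T x" by (rule eq) (simp add: T.scaleR TR)
  next
    fix x show "norm (inv T x) \<le> norm x * (1 / d)"
      using d(2)[of "inv T x"] d(1) by (simp add: TR field_simps)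
  qed
  moreover have "inv T (c *\<^sub>C x) = c *\<^sub>C inv T x" for c x
    using T by (intro eq) (simp add: bounded_operator_def TR)
  moreover have "inv T (smul a x) = smul a (inv T x)" for a x
    using T by (intro eq) (simp add: bounded_operator_def TR)
  ultimately show "bounded_operator smul (inv T)" by (simp add: bounded_operator_def)
qed

text \<open>The inverse has to be adjointable too, and its adjoint is the inverse of
  \<open>T'\<close>; hence the surjectivity of both operators.\<close>

lemma invertible_operatorI:
  assumes T: "bounded_operator smul T" and T': "bounded_operator smul T'"
    and adj: "is_adjoint ip T T'"
    and d: "0 < d" "\<And>x. d * norm x \<le> norm (T x)" and surj: "surj T"
    and surj': "surj T'"
  shows "invertible_operator smul ip T"
proof -
  note inv = bounded_operator_inv[OF T d surj]
  have TR: "T (inv T x) = x" for x by (simp add: surj surj_f_inv_f)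
  have TR': "T' (inv T' x) = x" for x by (simp add: surj' surj_f_inv_f)
  have "is_adjoint ip (inv T) (inv T')"
    using adj unfolding is_adjoint_def by (metis TR TR')
  then have "adjointable smul ip (inv T)" using inv by (auto simp: adjointable_def)
  moreover have "T \<circ> inv T = id" "inv T \<circ> T = id" using inv(2) TR by auto
  moreover have "adjointable smul ip T" using T adj by (auto simp: adjointable_def)
  ultimately show ?thesis by (auto simp: invertible_operator_def)
qed

lemma bounded_operator_minus_scaleC:
  assumes "bounded_operator smul T" shows "bounded_operator smul (\<lambda>x. T x - c *\<^sub>C x)"
  using assms unfolding bounded_operator_def
  by (auto intro!: bounded_linear_sub bounded_linear_scaleC
      simp: scaleC_diff_right smul_diff_right scaleC_smul_right scaleC_scaleC mult.commute)

text \<open>The lower bound is one in norm, not in the order of the algebra, so the usual comparison of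
  \<open>S\<close> with a multiple of the identity is not available.\<close>

lemma positive_invertible_operatorI:
  assumes S: "bounded_operator smul S" and sym: "is_adjoint ip S S"
    and pos: "\<And>x. ip (S x) x \<in> pos_cone"
    and d: "0 < d" "\<And>x. d * (norm x)\<^sup>2 \<le> norm (ip (S x) x)"
  shows "positive_operator smul ip S" "invertible_operator smul ip S"
proof -
  define U where "U c x = S x - c *\<^sub>C x" for c x
  have bop: "bounded_operator smul (U c)" for c
    using bounded_operator_minus_scaleC[OF S] by (simp add: U_def[abs_def])
  \<comment> \<open>Moving left along the real axis adds a positive element to
    \<open>ip (S x) x\<close>, which cannot decrease its norm.\<close>
  have neg: "d * norm x \<le> norm (U (complex_of_real (- r)) x)" if "0 \<le> r" for r x
  proof (rule norm_ge_of_ip)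
    have "ip (U (complex_of_real (- r)) x) x = ip (S x) x + r *\<^sub>R ip x x"
      by (simp only: U_def ip_diff_left ip_scaleC_left scaleC_of_real) (simp add: ip_minus_left ip_scaleR_left)
    then have "norm (ip (S x) x) \<le> norm (ip (U (complex_of_real (- r)) x) x)"
      using that by (intro norm_mono_pos_cone pos) (simp add: pos_cone_scaleR ip_self_pos_cone)
    then show "d * (norm x)\<^sup>2 \<le> norm (ip (U (complex_of_real (- r)) x) x)" using d(2)[of x] by simp
  qed
  have nonreal: "\<bar>Im c\<bar> * norm x \<le> norm (U c x)" for c x
  proof (rule norm_ge_of_ip)
    define u where "u = ip (U c x) x"
    have "star (ip (S x) x) = ip (S x) x" by (simp add: pos pos_cone_star)
    \<comment> \<open>The symmetric part cancels, so the imaginary part of \<open>c\<close> alone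
      controls \<open>ip (U c x) x\<close> from below.\<close>
    then have "star u - u = (c - cnj c) *\<^sub>C ip x x"
      by (simp add: u_def U_def ip_diff_left ip_scaleC_left star_diff star_scaleC ip_star)
         (simp only: diff_conv_add_uminus scaleC_add_left scaleC_minus_left add.commute)
    moreover have "cmod (c - cnj c) = 2 * \<bar>Im c\<bar>" by (simp add: complex_diff_cnj norm_mult)
    ultimately have "2 * \<bar>Im c\<bar> * norm (ip x x) = norm (star u - u)" by (simp add: norm_scaleC)
    also have "\<dots> \<le> 2 * norm u" using norm_triangle_ineq4[of "star u" u] by simp
    finally show "\<bar>Im c\<bar> * (norm x)\<^sup>2 \<le> norm (ip (U c x) x)" by (simp add: norm_square u_def)
  qed
  have U_shift: "U c x + b *\<^sub>C x = U (c - b) x" for b c x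
    by (simp add: U_def diff_conv_add_uminus scaleC_add_left scaleC_minus_left del: add_uminus_conv_diff)
  have below_surj: "\<exists>d>0. (\<forall>x. d * norm x \<le> norm (U c x)) \<and> surj (U c)"
    if c: "c = 0 \<or> c \<notin> \<real>\<^sub>\<ge>\<^sub>0" for c
  proof (cases "Im c = 0")
    case True
    define r where "r = - Re c"
    have r: "0 \<le> r" "c = complex_of_real (- r)"
      using c True by (auto simp: complex_nonneg_Reals_iff r_def complex_eq_iff)
    have "surj (U c)"
    proof (rule surj_of_uniformly_bounded_below[of _ 1 d])
      fix s :: real and x assume "0 \<le> s"
      then show "d * norm x \<le> norm (U c x + (complex_of_real s * 1) *\<^sub>C x)"
        using neg[of "r + s" x] r by (simp add: U_shift)
    qed (use bop d in \<open>auto simp: bounded_operator_def\<close>)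
    then show ?thesis using neg[OF r(1)] r(2) d(1) by auto
  next
    case False
    have "surj (U c)"
    proof (rule surj_of_uniformly_bounded_below[of _ "- (complex_of_real (sgn (Im c)) * \<i>)" "\<bar>Im c\<bar>"])
      fix s :: real and x :: 'h assume s: "0 \<le> s"
      \<comment> \<open>The sign makes the ray move away from the real axis, so that the imaginary
        part never shrinks along it.\<close>
      let ?b = "complex_of_real s * - (complex_of_real (sgn (Im c)) * \<i>)"
      have "\<bar>Im c\<bar> \<le> \<bar>Im (c - ?b)\<bar>" using s by (auto simp: sgn_if)
      then have "\<bar>Im c\<bar> * norm x \<le> \<bar>Im (c - ?b)\<bar> * norm x" by (rule mult_right_mono) simp
      also have "\<dots> \<le> norm (U (c - ?b) x)" by (rule nonreal)
      finally show "\<bar>Im c\<bar> * norm x \<le> norm (U c x + ?b *\<^sub>C x)" by (simp only: U_shift)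
    qed (use bop False in \<open>auto simp: bounded_operator_def norm_mult sgn_if\<close>)
    then show ?thesis using nonreal[of c] False by (intro exI[of _ "\<bar>Im c\<bar>"]) auto
  qed
  have inv: "invertible_operator smul ip (U c)" if c: "c = 0 \<or> c \<notin> \<real>\<^sub>\<ge>\<^sub>0" for c
  proof -
    have c': "cnj c = 0 \<or> cnj c \<notin> \<real>\<^sub>\<ge>\<^sub>0" using c by (auto simp: complex_nonneg_Reals_iff)
    have "is_adjoint ip (U c) (U (cnj c))"
      using sym by (simp add: is_adjoint_def U_def ip_diff_left ip_diff_right ip_scaleC_left ip_scaleC_right)
    then show ?thesis
      using below_surj[OF c] below_surj[OF c'] invertible_operatorI[OF bop bop] by blast
  qed
  show "invertible_operator smul ip S" using inv[of 0] by (simp add: U_def[abs_def])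
  have "selfadjoint_operator smul ip S"
    using S sym by (auto simp: selfadjoint_operator_def adjointable_def)
  moreover have "operator_spectrum smul ip S \<subseteq> \<real>\<^sub>\<ge>\<^sub>0"
    using inv by (auto simp: operator_spectrum_def U_def[abs_def])
  ultimately show "positive_operator smul ip S" by (simp add: positive_operator_def)
qed

end


section \<open>Orthogonal projections\<close>

context hilbert_module
begin

context
  fixes K assumes K: "orth_complemented smul ip K"
begin

lemma submodule_closed: "x \<in> K \<Longrightarrow> y \<in> K \<Longrightarrow> x + y \<in> K" "x \<in> K \<Longrightarrow> smul a x \<in> K"
  using K by (auto simp: orth_complemented_def submodule_def)

lemma orth_closed: "u \<in> orth ip K \<Longrightarrow> v \<in> orth ip K \<Longrightarrow> u + v \<in> orth ip K"
    "u \<in> orth ip K \<Longrightarrow> smul a u \<in> orth ip K"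
  by (auto simp: orth_def ip_add_left ip_smul_left)

lemma orth_decomposition_unique:
  assumes "k \<in> K" "x - k \<in> orth ip K" "k' \<in> K" "x - k' \<in> orth ip K" shows "k = k'"
proof -
  have "k - k' \<in> K"
    using submodule_closed(1)[OF assms(1) submodule_closed(2)[OF assms(3), of "- 1"]]
    by (simp add: smul_minus_one)
  moreover have "k - k' \<in> orth ip K"
    using orth_closed(1)[OF assms(4) orth_closed(2)[OF assms(2), of "- 1"]]
    by (simp add: smul_minus_one)
  ultimately have "k - k' \<in> {0}" using K unfolding orth_complemented_def by blast
  then show ?thesis by simp
qed

lemma orth_proj_eqI: "k \<in> K \<Longrightarrow> x - k \<in> orth ip K \<Longrightarrow> orth_proj ip K x = k"
  unfolding orth_proj_def using orth_decomposition_unique by blast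

lemma orth_proj_mem: "orth_proj ip K x \<in> K" "x - orth_proj ip K x \<in> orth ip K"
proof -
  obtain k u where "k \<in> K" "u \<in> orth ip K" "x = k + u"
    using K unfolding orth_complemented_def by blast
  then have "k \<in> K" "x - k \<in> orth ip K" by auto
  with orth_proj_eqI[OF this] show "orth_proj ip K x \<in> K" "x - orth_proj ip K x \<in> orth ip K" by auto
qed

lemma orth_proj_add: "orth_proj ip K (x + y) = orth_proj ip K x + orth_proj ip K y"
  using orth_closed(1)[OF orth_proj_mem(2) orth_proj_mem(2), of x y]
  by (intro orth_proj_eqI submodule_closed orth_proj_mem) (simp add: algebra_simps)

lemma orth_proj_smul: "orth_proj ip K (smul a x) = smul a (orth_proj ip K x)"
  using orth_closed(2)[OF orth_proj_mem(2), of a x]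
  by (intro orth_proj_eqI submodule_closed orth_proj_mem) (simp add: smul_diff_right)

lemma ip_orth_proj: "ip (orth_proj ip K x) y = ip (orth_proj ip K x) (orth_proj ip K y)"
proof -
  have "ip (y - orth_proj ip K y) (orth_proj ip K x) = 0"
    using orth_proj_mem by (auto simp: orth_def)
  then have "ip (orth_proj ip K x) (y - orth_proj ip K y) = 0" by (metis ip_star star_zero)
  then show ?thesis by (simp add: ip_diff_right)
qed

end

end


section \<open>The frame operator\<close>

text \<open>The data of the frame, with indices from 0 and squared moduli written as inner products.
  The single identity \<open>ip_P\<close> expresses that each \<open>P n\<close> is self-adjoint and
  idempotent.\<close>

locale weighted_projections = hilbert_module smul ip
  for smul :: "'a::unital_cstar_algebra \<Rightarrow> 'h::{complex_normed_vector, banach} \<Rightarrow> 'h"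
    and ip :: "'h \<Rightarrow> 'h \<Rightarrow> 'a" +
  fixes P :: "nat \<Rightarrow> 'h \<Rightarrow> 'h" and w :: "nat \<Rightarrow> 'a" and A B :: 'a
  assumes P_add: "P n (x + y) = P n x + P n y"
    and P_smul: "P n (smul a x) = smul a (P n x)"
    and ip_P: "ip (P n x) y = ip (P n x) (P n y)"
    and w_central: "w n * a = a * w n"
    and w_star: "star (w n) = w n"
    and summable_squares: "summable (\<lambda>n. (w n)\<^sup>2 * ip (P n x) (P n x))"
    and A_invertible: "alg_invertible A"
    and lower: "(\<Sum>n. (w n)\<^sup>2 * ip (P n x) (P n x)) - A * ip x x * star A \<in> pos_cone"
    and upper: "B * ip x x * star B - (\<Sum>n. (w n)\<^sup>2 * ip (P n x) (P n x)) \<in> pos_cone"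
begin

definition form :: "nat set \<Rightarrow> 'h \<Rightarrow> 'h \<Rightarrow> 'a" where
  "form I x y = (\<Sum>n\<in>I. (w n)\<^sup>2 * ip (P n x) (P n y))"

definition partial_op :: "nat set \<Rightarrow> 'h \<Rightarrow> 'h" where
  "partial_op I x = (\<Sum>n\<in>I. smul ((w n)\<^sup>2) (P n x))"

definition frame_op :: "'h \<Rightarrow> 'h" where
  "frame_op x = (\<Sum>n. smul ((w n)\<^sup>2) (P n x))"

lemma w_square_central: "(w n)\<^sup>2 * a = a * (w n)\<^sup>2"
  unfolding power2_eq_square by (metis mult.assoc w_central)

lemma star_term: "star ((w n)\<^sup>2 * ip (P n x) (P n y)) = (w n)\<^sup>2 * ip (P n y) (P n x)"
  by (simp add: star_mult ip_star w_star w_square_central power2_eq_square)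
     (metis power2_eq_square w_square_central)

text \<open>Centrality turns the product into a conjugation by the self-adjoint
  \<open>w n\<close>.\<close>

lemma term_pos_cone: "(w n)\<^sup>2 * ip (P n x) (P n x) \<in> pos_cone"
proof -
  have "(w n)\<^sup>2 * ip (P n x) (P n x) = w n * ip (P n x) (P n x) * star (w n)"
    by (metis mult.assoc power2_eq_square w_central w_star)
  then show ?thesis by (simp only: pos_cone_conj ip_self_pos_cone)
qed

lemma form_pos_cone: "form I x x \<in> pos_cone"
  unfolding form_def
  by (induction I rule: infinite_finite_induct) (auto intro: pos_cone_zero pos_cone_add term_pos_cone)

text \<open>Centrality of the squared weights makes \<open>form I\<close> linear over the algebra in
  its first variable and hermitian.\<close>

lemma form_Cauchy_Schwarz: "(norm (form I x y))\<^sup>2 \<le> norm (form I x x) * norm (form I y y)"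
proof (rule Cauchy_Schwarz_form)
  fix x y z show "form I (x + y) z = form I x z + form I y z"
    by (simp add: form_def P_add ip_add_left distrib_left sum.distrib)
next
  fix a x y
  have "(w n)\<^sup>2 * (a * c) = a * ((w n)\<^sup>2 * c)" for n c by (metis mult.assoc w_square_central)
  then show "form I (smul a x) y = a * form I x y"
    by (simp add: form_def P_smul ip_smul_left sum_distrib_left)
next
  fix x y
  have "star (sum f I) = (\<Sum>n\<in>I. star (f n))" for f :: "nat \<Rightarrow> 'a"
    by (induction I rule: infinite_finite_induct) (auto simp: star_add)
  then show "star (form I x y) = form I y x" by (simp add: form_def star_term)
qed (rule form_pos_cone)

text \<open>Partial sums beyond \<open>I\<close> differ from \<open>form I\<close> by a form over
  the remaining indices; closedness of the cone passes this to the limit.\<close>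

lemma form_le_suminf:
  assumes "finite I" shows "(\<Sum>n. (w n)\<^sup>2 * ip (P n x) (P n x)) - form I x x \<in> pos_cone"
proof (rule Lim_in_closed_set[OF closed_pos_cone])
  show "(\<lambda>N. form {..<N} x x - form I x x) \<longlonglongrightarrow> (\<Sum>n. (w n)\<^sup>2 * ip (P n x) (P n x)) - form I x x"
    unfolding form_def by (intro tendsto_diff tendsto_const summable_LIMSEQ summable_squares)
  obtain M where M: "I \<subseteq> {..<M}" using finite_nat_iff_bounded assms by blast
  show "\<forall>\<^sub>F N in sequentially. form {..<N} x x - form I x x \<in> pos_cone"
  proof (rule eventually_sequentiallyI[of M])
    fix N assume "M \<le> N"
    then have "I \<subseteq> {..<N}" using M by auto
    then have "form {..<N} x x - form I x x = form ({..<N} - I) x x"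
      unfolding form_def by (simp add: sum_diff)
    then show "form {..<N} x x - form I x x \<in> pos_cone" by (simp add: form_pos_cone)
  qed
qed simp

lemma norm_form_le: "finite I \<Longrightarrow> norm (form I x x) \<le> (norm B)\<^sup>2 * (norm x)\<^sup>2"
proof -
  assume "finite I"
  from pos_cone_add[OF form_le_suminf[OF this, of x] upper[of x]]
  have "norm (form I x x) \<le> norm (B * ip x x * star B)"
    by (intro norm_mono_pos_cone form_pos_cone) simp
  also have "B * ip x x * star B = ip (smul B x) (smul B x)"
    by (simp add: ip_smul_left ip_smul_right mult.assoc)
  also have "norm \<dots> \<le> (norm B * norm x)\<^sup>2"
    unfolding norm_square[symmetric] by (intro power_mono norm_smul_le) simp
  finally show ?thesis by (simp add: power_mult_distrib)
qed

text \<open>Cauchy--Schwarz for \<open>form I\<close> at the pair \<open>x, partial_op I x\<close>.\<close>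

lemma norm_partial_op:
  assumes "finite I" shows "(norm (partial_op I x))\<^sup>2 \<le> (norm B)\<^sup>2 * norm (form I x x)"
proof -
  define y where "y = partial_op I x"
  have "ip y z = form I x z" for z
    unfolding y_def partial_op_def form_def ip_sum_left ip_smul_left by (metis ip_P)
  then have "((norm y)\<^sup>2)\<^sup>2 = (norm (form I x y))\<^sup>2" by (simp add: norm_square)
  also have "\<dots> \<le> norm (form I x x) * norm (form I y y)" by (rule form_Cauchy_Schwarz)
  \<comment> \<open>The upper frame bound is applied at \<open>y\<close> itself, producing the
    factor that cancels below.\<close>
  also have "\<dots> \<le> norm (form I x x) * ((norm B)\<^sup>2 * (norm y)\<^sup>2)"
    by (intro mult_left_mono norm_form_le assms) simp
  finally have "(norm y)\<^sup>2 * (norm y)\<^sup>2 \<le> (norm B)\<^sup>2 * norm (form I x x) * (norm y)\<^sup>2"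
    by (simp add: power2_eq_square mult_ac)
  then have "(norm y)\<^sup>2 \<le> (norm B)\<^sup>2 * norm (form I x x)" if "y \<noteq> 0"
    by (rule mult_right_le_imp_le) (simp add: that)
  then show ?thesis unfolding y_def[symmetric] by (cases "y = 0") auto
qed

lemma summable_frame_op: "summable (\<lambda>n. smul ((w n)\<^sup>2) (P n x))"
  unfolding summable_Cauchy
proof (intro allI impI)
  fix e :: real assume e: "0 < e"
  \<comment> \<open>The summand 1 avoids division by zero and makes the final estimate
    strict.\<close>
  define \<delta> where "\<delta> = e\<^sup>2 / ((norm B)\<^sup>2 + 1)"
  have b: "(norm B)\<^sup>2 + 1 > 0" by (simp add: add_nonneg_pos)
  then have "\<delta> > 0" using e by (simp add: \<delta>_def)
  then obtain N where N: "norm (form {m..<n} x x) < \<delta>" if "m \<ge> N" for m n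
    using summable_squares[of x] unfolding summable_Cauchy form_def by blast
  have "norm (\<Sum>n\<in>{m..<n}. smul ((w n)\<^sup>2) (P n x)) < e" if "m \<ge> N" for m n
  proof (rule power2_less_imp_less)
    have "(norm (partial_op {m..<n} x))\<^sup>2 \<le> (norm B)\<^sup>2 * norm (form {m..<n} x x)"
      by (rule norm_partial_op) simp
    also have "\<dots> \<le> (norm B)\<^sup>2 * \<delta>" using N[OF that, of n] by (intro mult_left_mono) auto
    also have "\<dots> < ((norm B)\<^sup>2 + 1) * \<delta>" using \<open>\<delta> > 0\<close> by (simp add: algebra_simps)
    also have "\<dots> = e\<^sup>2" using b by (simp add: \<delta>_def)
    finally show "(norm (\<Sum>n\<in>{m..<n}. smul ((w n)\<^sup>2) (P n x)))\<^sup>2 < e\<^sup>2"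
      by (simp add: partial_op_def)
  qed (use e in simp)
  then show "\<exists>N. \<forall>m\<ge>N. \<forall>n. norm (\<Sum>n\<in>{m..<n}. smul ((w n)\<^sup>2) (P n x)) < e" by blast
qed

lemma norm_frame_op_le: "norm (frame_op x) \<le> (norm B)\<^sup>2 * norm x"
proof (rule LIMSEQ_le_const2)
  show "(\<lambda>n. norm (partial_op {..<n} x)) \<longlonglongrightarrow> norm (frame_op x)"
    unfolding partial_op_def frame_op_def
    by (intro tendsto_norm summable_LIMSEQ summable_frame_op)
  have "norm (partial_op {..<n} x) \<le> (norm B)\<^sup>2 * norm x" for n
  proof (rule power2_le_imp_le)
    have "(norm (partial_op {..<n} x))\<^sup>2 \<le> (norm B)\<^sup>2 * norm (form {..<n} x x)"
      by (rule norm_partial_op) simp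
    also have "\<dots> \<le> (norm B)\<^sup>2 * ((norm B)\<^sup>2 * (norm x)\<^sup>2)"
      by (intro mult_left_mono norm_form_le) auto
    finally show "(norm (partial_op {..<n} x))\<^sup>2 \<le> ((norm B)\<^sup>2 * norm x)\<^sup>2"
      by (simp add: power2_eq_square mult_ac)
  qed simp
  then show "\<exists>N. \<forall>n\<ge>N. norm (partial_op {..<n} x) \<le> (norm B)\<^sup>2 * norm x" by blast
qed

lemma frame_op_smul: "frame_op (smul a x) = smul a (frame_op x)"
proof -
  have "smul a (frame_op x) = (\<Sum>n. smul a (smul ((w n)\<^sup>2) (P n x)))"
    unfolding frame_op_def by (rule bounded_linear.suminf[OF bounded_linear_smul summable_frame_op])
  then show ?thesis by (simp add: frame_op_def P_smul smul_smul w_square_central)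
qed

lemma frame_op_scaleC: "frame_op (c *\<^sub>C x) = c *\<^sub>C frame_op x"
  using frame_op_smul[of "c *\<^sub>C 1" x] by (simp add: smul_scaleC_one)

lemma bounded_operator_frame_op: "bounded_operator smul frame_op"
proof -
  have "bounded_linear frame_op"
  proof (rule bounded_linear_intro[where K="(norm B)\<^sup>2"])
    fix x y show "frame_op (x + y) = frame_op x + frame_op y"
      unfolding frame_op_def P_add smul_add_right
      by (rule suminf_add[symmetric]) (rule summable_frame_op)+
  next
    fix r x show "frame_op (r *\<^sub>R x) = r *\<^sub>R frame_op x" by (metis frame_op_scaleC scaleC_of_real)
  qed (use norm_frame_op_le in \<open>simp add: mult.commute\<close>)
  then show ?thesis by (simp add: bounded_operator_def frame_op_scaleC frame_op_smul)
qed

lemma ip_frame_op_sums: "(\<lambda>n. (w n)\<^sup>2 * ip (P n x) (P n y)) sums ip (frame_op x) y"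
proof -
  have "(\<lambda>n. ip (smul ((w n)\<^sup>2) (P n x)) y) sums ip (frame_op x) y"
    unfolding frame_op_def
    by (rule bounded_linear.sums[OF bounded_linear_ip_left summable_sums[OF summable_frame_op]])
  moreover have "ip (smul ((w n)\<^sup>2) (P n x)) y = (w n)\<^sup>2 * ip (P n x) (P n y)" for n
    by (metis ip_P ip_smul_left)
  ultimately show ?thesis by simp
qed

lemma frame_op_is_adjoint: "is_adjoint ip frame_op frame_op"
  unfolding is_adjoint_def
proof (intro allI)
  fix x y
  have "(\<lambda>n. star ((w n)\<^sup>2 * ip (P n y) (P n x))) sums star (ip (frame_op y) x)"
    by (rule bounded_linear.sums[OF bounded_linear_star ip_frame_op_sums])
  then have "(\<lambda>n. (w n)\<^sup>2 * ip (P n x) (P n y)) sums ip x (frame_op y)"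
    by (simp add: star_term ip_star)
  then show "ip (frame_op x) y = ip x (frame_op y)" using ip_frame_op_sums sums_unique2 by blast
qed

lemma ip_frame_op_eq: "ip (frame_op x) x = (\<Sum>n. (w n)\<^sup>2 * ip (P n x) (P n x))"
  using ip_frame_op_sums sums_unique by blast

text \<open>The empty index set in \<open>form_le_suminf\<close>.\<close>

lemma ip_frame_op_pos_cone: "ip (frame_op x) x \<in> pos_cone"
  using form_le_suminf[of "{}" x] by (simp add: ip_frame_op_eq form_def)

text \<open>A left inverse \<open>C\<close> of \<open>A\<close> recovers x from A x, so |x|^2 is at
  most |C|^2 times the norm of the lower frame bound. The 1 in \<open>d\<close> covers
  \<open>C = 0\<close>, which occurs in the zero algebra.\<close>

lemma frame_op_bounded_below:
  obtains d where "0 < d" "\<And>x. d * (norm x)\<^sup>2 \<le> norm (ip (frame_op x) x)"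
proof -
  obtain C where C: "C * A = 1" using A_invertible by (auto simp: alg_invertible_def)
  define d where "d = 1 / ((norm C)\<^sup>2 + 1)"
  have c: "(norm C)\<^sup>2 + 1 > 0" by (simp add: add_nonneg_pos)
  have "d * (norm x)\<^sup>2 \<le> norm (ip (frame_op x) x)" for x
  proof -
    have "x = smul C (smul A x)" by (simp add: smul_smul C smul_one)
    then have "(norm x)\<^sup>2 \<le> (norm C * norm (smul A x))\<^sup>2"
      by (metis norm_ge_zero norm_smul_le power_mono)
    also have "\<dots> = (norm C)\<^sup>2 * norm (A * ip x x * star A)"
      by (simp add: power_mult_distrib norm_square ip_smul_left ip_smul_right mult.assoc)
    also have "\<dots> \<le> (norm C)\<^sup>2 * norm (ip (frame_op x) x)"
      using lower[of x] unfolding ip_frame_op_eq[symmetric]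
      by (intro mult_left_mono norm_mono_pos_cone pos_cone_conj ip_self_pos_cone) auto
    also have "\<dots> \<le> ((norm C)\<^sup>2 + 1) * norm (ip (frame_op x) x)"
      by (intro mult_right_mono) auto
    finally show ?thesis using c by (simp add: d_def divide_le_eq mult.commute)
  qed
  then show thesis using that[of d] c by (simp add: d_def)
qed

end

theorem theorem3p4:
  fixes smul :: "'a::unital_cstar_algebra \<Rightarrow> 'h::{complex_normed_vector, banach} \<Rightarrow> 'h"
    and ip :: "'h \<Rightarrow> 'h \<Rightarrow> 'a"
    and H :: "nat \<Rightarrow> 'h set"
    and \<omega> :: "nat \<Rightarrow> 'a"
  assumes "hilbert_module smul ip"
    and "star_fusion_frame smul ip H \<omega>"
  shows "(\<forall>x. summable (\<lambda>n. smul ((\<omega> (Suc n))\<^sup>2) (orth_proj ip (H (Suc n)) x))) \<and>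
    bounded_operator smul (frame_operator smul ip H \<omega>) \<and>
    positive_operator smul ip (frame_operator smul ip H \<omega>) \<and>
    selfadjoint_operator smul ip (frame_operator smul ip H \<omega>) \<and>
    invertible_operator smul ip (frame_operator smul ip H \<omega>) \<and>
    (\<forall>x. (\<lambda>n. smul ((\<omega> (Suc n))\<^sup>2)
            (orth_proj ip (H (Suc n)) (inv (frame_operator smul ip H \<omega>) x))) sums x)"
proof -
  interpret hilbert_module smul ip by (rule assms(1))
  define P where "P n = orth_proj ip (H (Suc n))" for n
  define w where "w n = \<omega> (Suc n)" for n
  have H: "orth_complemented smul ip (H (Suc n))" for n
    using assms(2) by (simp add: star_fusion_frame_def)
  have w: "central (w n)" "strictly_positive (w n)" for n
    using assms(2) by (auto simp: star_fusion_frame_def weight_def w_def)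
  obtain A B where A: "strictly_positive A"
    and lower: "\<And>x. (hmod ip (smul A x))\<^sup>2 \<preceq> (\<Sum>n. (w n)\<^sup>2 * ip (P n x) (P n x))"
    and upper: "\<And>x. (\<Sum>n. (w n)\<^sup>2 * ip (P n x) (P n x)) \<preceq> (hmod ip (smul B x))\<^sup>2"
    using assms(2) unfolding star_fusion_frame_def hmod_square P_def w_def by blast
  have hmod_smul: "(hmod ip (smul a x))\<^sup>2 = a * ip x x * star a" for a x
    by (simp add: hmod_square ip_smul_left ip_smul_right mult.assoc)
  interpret weighted_projections smul ip P w A B
  proof
    show "P n (x + y) = P n x + P n y" "P n (smul a x) = smul a (P n x)"
      "ip (P n x) y = ip (P n x) (P n y)" for n x y a
      unfolding P_def by (rule orth_proj_add[OF H] orth_proj_smul[OF H] ip_orth_proj[OF H])+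
    show "w n * a = a * w n" for n a using w(1) by (simp add: central_def)
    show "star (w n) = w n" for n by (rule strictly_positive_star[OF w(2)])
    show "summable (\<lambda>n. (w n)\<^sup>2 * ip (P n x) (P n x))" for x
      using assms(2) unfolding star_fusion_frame_def hmod_square P_def w_def by blast
    show "alg_invertible A" by (rule strictly_positive_invertible[OF A])
    show "(\<Sum>n. (w n)\<^sup>2 * ip (P n x) (P n x)) - A * ip x x * star A \<in> pos_cone"
      "B * ip x x * star B - (\<Sum>n. (w n)\<^sup>2 * ip (P n x) (P n x)) \<in> pos_cone" for x
      using lower[of x] upper[of x] by (simp_all add: cstar_le_def hmod_smul positive_iff)
  qed
  have S: "frame_operator smul ip H \<omega> = frame_op"
    by (simp add: fun_eq_iff frame_operator_def frame_op_def P_def w_def)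
  obtain d where d: "0 < d" "\<And>x. d * (norm x)\<^sup>2 \<le> norm (ip (frame_op x) x)"
    using frame_op_bounded_below by blast
  note pos_inv = positive_invertible_operatorI[OF bounded_operator_frame_op frame_op_is_adjoint
      ip_frame_op_pos_cone d]
  from pos_inv(2) have "surj frame_op"
    by (metis comp_apply id_apply invertible_operator_def surjI)
  \<comment> \<open>The reconstruction formula is the series for the frame operator evaluated at the
    preimage of \<open>x\<close>.\<close>
  then have "frame_op (inv frame_op x) = x" for x by (rule surj_f_inv_f)
  then have "(\<lambda>n. smul ((w n)\<^sup>2) (P n (inv frame_op x))) sums x" for x
    using summable_sums[OF summable_frame_op[of "inv frame_op x"]] by (simp add: frame_op_def)
  moreover have "selfadjoint_operator smul ip frame_op"
    using pos_inv(1) by (simp add: positive_operator_def)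
  ultimately show ?thesis
    unfolding S using pos_inv bounded_operator_frame_op summable_frame_op
    by (simp add: P_def w_def)
qed

end
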